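(* Let $G$ be an $n$-vertex graph. If $G$ is connected, then $\mathrm{lpt}(G)\le 8n^{3/4}$. If $G$ is $2$-connected, then $\mathrm{lct}(G)\le 20n^{3/4}$.
   Context: Graphs are finite and simple. $\mathrm{lpt}(G)$ is the minimum size of a longest path transversal of $G$, that is, of a set of vertices of $G$ that intersects the vertex set of every longest path in $G$. $\mathrm{lct}(G)$ is the minimum size of a set $S$ of vertices of $G$ such that $S$ intersects the vertex set of every longest cycle in $G$. A graph $G$ is $k$-connected if $|V(G)|>k$ and $G-S$ is connected for each $S\subseteq V(G)$ with $|S|<k$. *)

theory Defs
  imports
    Complex_Main
    "Graph_Theory.Digraph_Component"
    "Graph_Theory.Vertex_Walk"
begin

text \<open>
  A finite simple graph is a \<^locale>\<open>graph\<close>: a finite loop-free symmetric digraph without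
  parallel arcs, each edge being represented by its two orientations. In such a graph paths are
  determined by their vertex sequences, so the vertex-list notion \<^const>\<open>vpath\<close> is used; its
  length \<^const>\<open>vwalk_length\<close> counts edges.
\<close>

definition longest_path :: "'a vwalk \<Rightarrow> ('a, 'b) pre_digraph \<Rightarrow> bool" where
  "longest_path p G \<longleftrightarrow> vpath p G \<and> (\<forall>q. vpath q G \<longrightarrow> vwalk_length q \<le> vwalk_length p)"

text \<open>
  A cycle is given by its vertices in cyclic order, the first one not being repeated at the end:
  a path together with an edge joining its ends. Hence the list length is the number of edges.
  The predicate \<^const>\<open>pre_digraph.cycle\<close> is not suitable for undirected graphs, because it
  accepts the traversal of a single edge back and forth; the bound 3 excludes this.
\<close>

definition vcycle :: "'a list \<Rightarrow> ('a, 'b) pre_digraph \<Rightarrow> bool" where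
  "vcycle c G \<longleftrightarrow> vpath c G \<and> 3 \<le> length c \<and> last c \<rightarrow>\<^bsub>G\<^esub> hd c"

definition longest_cycle :: "'a list \<Rightarrow> ('a, 'b) pre_digraph \<Rightarrow> bool" where
  "longest_cycle c G \<longleftrightarrow> vcycle c G \<and> (\<forall>d. vcycle d G \<longrightarrow> length d \<le> length c)"

definition longest_path_transversal :: "'a set \<Rightarrow> ('a, 'b) pre_digraph \<Rightarrow> bool" where
  "longest_path_transversal S G \<longleftrightarrow>
     S \<subseteq> verts G \<and> (\<forall>p. longest_path p G \<longrightarrow> S \<inter> set p \<noteq> {})"

definition longest_cycle_transversal :: "'a set \<Rightarrow> ('a, 'b) pre_digraph \<Rightarrow> bool" where
  "longest_cycle_transversal S G \<longleftrightarrow>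
     S \<subseteq> verts G \<and> (\<forall>c. longest_cycle c G \<longrightarrow> S \<inter> set c \<noteq> {})"

text \<open>
  The minima below are attained for every \<^locale>\<open>graph\<close>, since the set of all vertices is a
  transversal. A graph without cycles has \<open>lct G = 0\<close>.
\<close>

definition lpt :: "('a, 'b) pre_digraph \<Rightarrow> nat" where
  "lpt G = (LEAST k. \<exists>S. longest_path_transversal S G \<and> card S = k)"

definition lct :: "('a, 'b) pre_digraph \<Rightarrow> nat" where
  "lct G = (LEAST k. \<exists>S. longest_cycle_transversal S G \<and> card S = k)"

text \<open>
  The qualified name is needed because \<open>connected\<close> also denotes topological connectedness.
  The graph notion excludes the graph without vertices.
\<close>

definition k_connected :: "nat \<Rightarrow> ('a, 'b) pre_digraph \<Rightarrow> bool" where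
  "k_connected k G \<longleftrightarrow>
     k < card (verts G) \<and>
     (\<forall>S \<subseteq> verts G. card S < k \<longrightarrow> Digraph_Component.connected (G \<restriction> (verts G - S)))"

end

theory Submission
  imports Defs
begin

text \<open>
  Let \<open>F\<close> be the family of longest paths (or cycles); connectivity makes its members meet pairwise.
  For a set \<open>A\<close> of vertices consider the least number of vertices that pierce all members of \<open>F\<close>
  meeting \<open>A\<close>. Suppose \<open>F\<close> cannot be pierced by \<open>4K\<close> vertices, where \<open>K\<^sup>2 \<ge> n\<close>. A chord of one member
  gives a cycle needing at least \<open>2K\<close> vertices; let \<open>C\<close> be a shortest such cycle.
  If some \<open>Q \<in> F\<close> avoids \<open>C\<close>, then \<open>C\<close> cannot be cut off from each of the \<open>2K - 1\<close> blocks of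
  \<open>K\<close> vertices of \<open>Q\<close> by one vertex per block, so two disjoint links join \<open>C\<close> to one block, and the
  detour along the longer arc of \<open>C\<close> makes \<open>Q\<close> longer.
  If all members of \<open>F\<close> meet \<open>C\<close>, then \<open>C\<close> is isometric, since a short chord would produce a shorter
  cycle needing \<open>2K\<close> vertices. Hence \<open>C\<close> contains two arcs at distance more than \<open>K\<close>, each needing \<open>K\<close>
  vertices; every breadth-first layer between them separates them and has at least \<open>K\<close> vertices, so
  \<open>n > K\<^sup>2\<close>, a contradiction. With \<open>K = \<lceil>\<surd>n\<rceil>\<close> this pierces \<open>F\<close> by at most \<open>8\<surd>n\<close> vertices.
\<close>

section \<open>Disjoint walks\<close>

definition walk_between :: "('a \<Rightarrow> 'a \<Rightarrow> bool) \<Rightarrow> 'a set \<Rightarrow> 'a set \<Rightarrow> 'a list \<Rightarrow> bool" where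
  "walk_between E A B xs \<longleftrightarrow> xs \<noteq> [] \<and> successively E xs \<and> hd xs \<in> A \<and> last xs \<in> B"

text \<open>Take a shortest walk among those with vertices in \<open>xs\<close>: cutting out a loop,
  starting at a later vertex of \<open>A\<close> or stopping at an earlier vertex of
  \<open>B\<close> would shorten it.\<close>

lemma walk_between_trim:
  assumes "walk_between E A B xs"
  obtains ys where "walk_between E A B ys" "distinct ys" "set ys \<subseteq> set xs"
    "set ys \<inter> A = {hd ys}" "set ys \<inter> B = {last ys}"
proof -
  let ?P = "\<lambda>ys. walk_between E A B ys \<and> set ys \<subseteq> set xs"
  have "?P xs" using assms by auto
  then obtain ys where ys: "?P ys" and min: "\<And>zs. ?P zs \<Longrightarrow> length ys \<le> length zs"
    using ex_has_least_nat[of ?P xs length] by blast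
  have ne: "ys \<noteq> []" using ys by (auto simp: walk_between_def)
  have "distinct ys"
  proof (rule ccontr)
    assume "\<not> distinct ys"
    then obtain us vs ws z where e: "ys = us @ [z] @ vs @ [z] @ ws"
      using not_distinct_decomp by blast
    then have "?P (us @ [z] @ ws)"
      using ys by (auto simp: walk_between_def successively_append_iff successively_Cons hd_append split: if_splits)
    from min[OF this] show False using e by simp
  qed
  moreover have "z = hd ys" if z: "z \<in> set ys" "z \<in> A" for z
  proof -
    obtain us vs where e: "ys = us @ z # vs" using z by (meson split_list)
    have "?P (z # vs)" using ys z unfolding e walk_between_def
      by (auto simp: successively_append_iff)
    from min[OF this] show ?thesis using e by simp
  qed
  moreover have "z = last ys" if z: "z \<in> set ys" "z \<in> B" for z
  proof -
    obtain us vs where e: "ys = us @ z # vs" using z by (meson split_list)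
    have "?P (us @ [z])" using ys z unfolding e walk_between_def
      by (auto simp: successively_append_iff successively_Cons hd_append split: if_splits)
    from min[OF this] show ?thesis using e by simp
  qed
  moreover have "hd ys \<in> A" "last ys \<in> B" using ys by (auto simp: walk_between_def)
  ultimately show ?thesis using that[of ys] ys ne by fastforce
qed

lemma walk_between_join:
  assumes "walk_between E A B xs" "walk_between E B' C ys" "last xs = hd ys"
  shows "walk_between E A C (xs @ tl ys)"
  using assms
  by (cases ys) (auto simp: walk_between_def successively_append_iff successively_Cons last_append)

lemma walk_between_mono:
  "walk_between E A B xs \<Longrightarrow> A \<subseteq> A' \<Longrightarrow> B \<subseteq> B' \<Longrightarrow> walk_between E A' B' xs"
  by (auto simp: walk_between_def)

lemma walk_between_prefix:
  assumes "walk_between E A B xs" "s \<in> set xs"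
  obtains us vs where "xs = us @ s # vs" "s \<notin> set us" "walk_between E A {s} (us @ [s])"
    "walk_between E {s} B (s # vs)"
proof -
  obtain us vs where e: "xs = us @ s # vs" "s \<notin> set us"
    using split_list_first[OF assms(2)] by blast
  show ?thesis using assms by (intro that[OF e])
      (auto simp: e walk_between_def successively_append_iff successively_Cons hd_append split: if_splits)
qed

lemma walk_between_suffix:
  assumes "walk_between E A B xs" "s \<in> set xs"
  obtains us vs where "xs = us @ s # vs" "s \<notin> set vs" "walk_between E A {s} (us @ [s])"
    "walk_between E {s} B (s # vs)"
proof -
  obtain us vs where e: "xs = us @ s # vs" "s \<notin> set vs"
    using split_list_last[OF assms(2)] by blast
  show ?thesis using assms by (intro that[OF e])
      (auto simp: e walk_between_def successively_append_iff successively_Cons hd_append split: if_splits)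
qed

text \<open>The cut is made at the first step outside \<open>r\<close>; such a step can only be the
  new edge, hence starts at \<open>u\<close>.\<close>

lemma successively_insert_edge_cases:
  assumes "successively (\<lambda>x y. (x, y) \<in> insert (u, v) r) xs"
  shows "successively (\<lambda>x y. (x, y) \<in> r) xs \<or>
    (\<exists>us vs. xs = us @ vs \<and> us \<noteq> [] \<and> vs \<noteq> [] \<and> last us = u \<and> successively (\<lambda>x y. (x, y) \<in> r) us)"
  using assms
proof (induction xs rule: rev_induct)
  case (snoc a xs)
  show ?case
  proof (cases "xs = []")
    case False
    have s: "successively (\<lambda>x y. (x, y) \<in> insert (u, v) r) xs"
      and l: "(last xs, a) \<in> insert (u, v) r"
      using snoc.prems False by (auto simp: successively_append_iff)
    from snoc.IH[OF s] show ?thesis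
    proof
      assume c: "successively (\<lambda>x y. (x, y) \<in> r) xs"
      show ?thesis
      proof (cases "(last xs, a) \<in> r")
        case True then show ?thesis using c by (auto simp: successively_append_iff)
      next
        case F: False
        then have "last xs = u" using l by auto
        then show ?thesis using c False by blast
      qed
    next
      assume "\<exists>us vs. xs = us @ vs \<and> us \<noteq> [] \<and> vs \<noteq> [] \<and> last us = u \<and> successively (\<lambda>x y. (x, y) \<in> r) us"
      then obtain us vs where "xs = us @ vs" "us \<noteq> []" "last us = u" "successively (\<lambda>x y. (x, y) \<in> r) us"
        by blast
      then have "xs @ [a] = us @ (vs @ [a]) \<and> us \<noteq> [] \<and> vs @ [a] \<noteq> [] \<and> last us = u \<and> successively (\<lambda>x y. (x, y) \<in> r) us"
        by simp
      then show ?thesis by blast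
    qed
  qed simp
qed simp

lemma walk_between_insert_edge_prefix:
  assumes "walk_between (\<lambda>x y. (x, y) \<in> insert (u, v) r) A B xs"
    "\<not> walk_between (\<lambda>x y. (x, y) \<in> r) A B xs"
  obtains ys where "walk_between (\<lambda>x y. (x, y) \<in> r) A {u} ys" "set ys \<subseteq> set xs"
proof -
  obtain us vs where "xs = us @ vs" "us \<noteq> []" "last us = u" "successively (\<lambda>x y. (x, y) \<in> r) us"
    using successively_insert_edge_cases[of u v r xs] assms unfolding walk_between_def by blast
  then show ?thesis using assms by (intro that[of us]) (auto simp: walk_between_def)
qed

lemma walk_between_converse:
  "walk_between (\<lambda>x y. (x, y) \<in> r) A B xs \<longleftrightarrow> walk_between (\<lambda>x y. (x, y) \<in> r\<inverse>) B A (rev xs)"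
  by (auto simp: walk_between_def hd_rev last_rev)

lemma walk_between_insert_edge_suffix:
  assumes "walk_between (\<lambda>x y. (x, y) \<in> insert (u, v) r) A B xs"
    "\<not> walk_between (\<lambda>x y. (x, y) \<in> r) A B xs"
  obtains ys where "walk_between (\<lambda>x y. (x, y) \<in> r) {v} B ys" "set ys \<subseteq> set xs"
proof -
  have i: "(insert (u, v) r)\<inverse> = insert (v, u) (r\<inverse>)" by auto
  have "walk_between (\<lambda>x y. (x, y) \<in> insert (v, u) (r\<inverse>)) B A (rev xs)"
    using assms(1) i by (subst (asm) walk_between_converse) simp
  moreover have "\<not> walk_between (\<lambda>x y. (x, y) \<in> r\<inverse>) B A (rev xs)"
    using assms(2) walk_between_converse by blast
  ultimately obtain ys where "walk_between (\<lambda>x y. (x, y) \<in> r\<inverse>) B {v} ys" "set ys \<subseteq> set (rev xs)"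
    by (rule walk_between_insert_edge_prefix)
  then show ?thesis using that[of "rev ys"] walk_between_converse[of r "{v}" B "rev ys"] by simp
qed

lemma walk_between_to_pair:
  assumes "walk_between E A {s, u} p" "walk_between E A {s, u} q" "set p \<inter> set q = {}"
  obtains p1 p2 where "walk_between E A {s} p1" "walk_between E A {u} p2" "set p1 \<inter> set p2 = {}" "s \<noteq> u"
proof -
  have "last p \<in> set p" "last q \<in> set q" using assms by (auto simp: walk_between_def)
  then have "last p \<noteq> last q" using assms(3) by auto
  then have "last p = s \<and> last q = u \<and> s \<noteq> u \<or> last p = u \<and> last q = s \<and> s \<noteq> u"
    using assms by (auto simp: walk_between_def)
  then show ?thesis
    using that[of p q] that[of q p] assms unfolding walk_between_def by auto
qed

text \<open>Menger's theorem for two paths, by Goering's induction: delete an edge \<open>(u, v)\<close>; if a single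
  vertex \<open>s\<close> now separates, link \<open>A\<close> to \<open>{s, u}\<close> and \<open>{s, v}\<close> to \<open>B\<close>.\<close>

lemma menger_two_rel:
  assumes "finite r" "\<And>x. \<exists>xs. walk_between (\<lambda>x y. (x, y) \<in> r) A B xs \<and> x \<notin> set xs"
  shows "\<exists>xs ys. walk_between (\<lambda>x y. (x, y) \<in> r) A B xs \<and> walk_between (\<lambda>x y. (x, y) \<in> r) A B ys
    \<and> set xs \<inter> set ys = {}"
  using assms
proof (induction r arbitrary: A B rule: finite_induct)
  case empty
  \<comment> \<open>Without edges a walk is a single vertex of both sets, so a walk that avoids the
    first such vertex is disjoint from it.\<close>
  have single: "\<exists>a. xs = [a]" if "walk_between (\<lambda>x y. (x, y) \<in> {}) A B xs" for xs
    using that by (cases xs rule: remdups_adj.cases) (auto simp: walk_between_def)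
  obtain xs where xs: "walk_between (\<lambda>x y. (x, y) \<in> {}) A B xs" using empty.prems by blast
  then obtain a where a: "xs = [a]" using single by blast
  obtain ys where ys: "walk_between (\<lambda>x y. (x, y) \<in> {}) A B ys" "a \<notin> set ys"
    using empty.prems by blast
  then show ?case using xs a by (intro exI[of _ xs] exI[of _ ys]) auto
next
  case (insert e r)
  obtain u v where e: "e = (u, v)" by (cases e)
  let ?W = "walk_between (\<lambda>x y. (x, y) \<in> r)"
  let ?W' = "walk_between (\<lambda>x y. (x, y) \<in> insert e r)"
  have mono: "?W' A B xs" if "?W A B xs" for A B xs
    using that by (auto simp: walk_between_def elim: successively_mono)
  show ?case
  proof (cases "\<forall>x. \<exists>xs. ?W A B xs \<and> x \<notin> set xs")
    case True
    then show ?thesis using insert.IH[of A B] mono by blast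
  next
    case False
    then obtain s where s: "\<And>xs. ?W A B xs \<Longrightarrow> s \<in> set xs" by blast
    \<comment> \<open>A walk avoiding \<open>x\<close> in the larger relation either survives in
      \<open>r\<close> and is cut at \<open>s\<close>, or is cut at \<open>u\<close> before it uses
      the new edge. So no vertex separates \<open>A\<close> from \<open>{s, u}\<close>, and the
      induction hypothesis applies.\<close>
    have "\<exists>xs. ?W A {s, u} xs \<and> x \<notin> set xs" for x
    proof -
      obtain xs where xs: "?W' A B xs" "x \<notin> set xs" using insert.prems by blast
      show ?thesis
      proof (cases "?W A B xs")
        case True
        obtain us vs where "xs = us @ s # vs" "?W A {s} (us @ [s])"
          by (rule walk_between_prefix[OF True s[OF True]])
        then show ?thesis using xs(2)
          by (intro exI[of _ "us @ [s]"]) (auto intro: walk_between_mono)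
      next
        case False
        then obtain ys where "?W A {u} ys" "set ys \<subseteq> set xs"
          using xs(1) e walk_between_insert_edge_prefix[of u v r A B xs] by metis
        then show ?thesis using xs(2) 
          by (intro exI[of _ ys]) (auto intro: walk_between_mono)
      qed
    qed
    from insert.IH[OF this] obtain p p' where
      "?W A {s, u} p" "?W A {s, u} p'" "set p \<inter> set p' = {}" by blast
    then obtain p1 p2 where
      p: "?W A {s} p1" "?W A {u} p2" "set p1 \<inter> set p2 = {}" "s \<noteq> u"
      by (rule walk_between_to_pair)
    have "\<exists>xs. ?W {s, v} B xs \<and> x \<notin> set xs" for x
    proof -
      obtain xs where xs: "?W' A B xs" "x \<notin> set xs" using insert.prems by blast
      show ?thesis
      proof (cases "?W A B xs")
        case True
        obtain us vs where "xs = us @ s # vs" "?W {s} B (s # vs)"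
          by (rule walk_between_prefix[OF True s[OF True]])
        then show ?thesis using xs(2)
          by (intro exI[of _ "s # vs"]) (auto intro: walk_between_mono)
      next
        case False
        then obtain ys where "?W {v} B ys" "set ys \<subseteq> set xs"
          using xs(1) e walk_between_insert_edge_suffix[of u v r A B xs] by metis
        then show ?thesis using xs(2) 
          by (intro exI[of _ ys]) (auto intro: walk_between_mono)
      qed
    qed
    from insert.IH[OF this] obtain q q' where
      qq: "?W {s, v} B q" "?W {s, v} B q'" "set q \<inter> set q' = {}" by blast
    \<comment> \<open>Reversal turns sources into targets, so that
      \<open>walk_between_to_pair\<close> applies here too.\<close>
    have "walk_between (\<lambda>x y. (x, y) \<in> r\<inverse>) B {s, v} (rev q)"
      "walk_between (\<lambda>x y. (x, y) \<in> r\<inverse>) B {s, v} (rev q')"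
      "set (rev q) \<inter> set (rev q') = {}"
      using qq(3) qq(1,2)[THEN iffD1[OF walk_between_converse]] by simp_all
    then obtain q1 q2 where
      q: "walk_between (\<lambda>x y. (x, y) \<in> r\<inverse>) B {s} q1" "walk_between (\<lambda>x y. (x, y) \<in> r\<inverse>) B {v} q2"
      "set q1 \<inter> set q2 = {}" "s \<noteq> v"
      by (rule walk_between_to_pair)
    then have q: "?W {s} B (rev q1)" "?W {v} B (rev q2)" "set (rev q1) \<inter> set (rev q2) = {}" "s \<noteq> v"
      using walk_between_converse[of r "{s}" B "rev q1"] walk_between_converse[of r "{v}" B "rev q2"]
      by simp_all
    have "s \<in> set p1" "s \<in> set (rev q1)"
      using p q last_in_set[of p1] hd_in_set[of "rev q1"] unfolding walk_between_def by auto
    \<comment> \<open>The walk to \<open>s\<close> is cut at its first visit there and the walk from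
      \<open>s\<close> at its last, so \<open>s\<close> occurs in each only as an end.\<close>
    obtain p1' where p1': "?W A {s} (p1' @ [s])" "s \<notin> set p1'" "set (p1' @ [s]) \<subseteq> set p1"
      by (rule walk_between_prefix[OF p(1) \<open>s \<in> set p1\<close>]) (use that in auto)
    obtain q1' where q1': "?W {s} B (s # q1')" "s \<notin> set q1'" "set (s # q1') \<subseteq> set (rev q1)"
      by (rule walk_between_suffix[OF q(1) \<open>s \<in> set (rev q1)\<close>]) (use that in auto)
    have sn: "s \<notin> set p2" "s \<notin> set (rev q2)"
      using p(3) q(3) \<open>s \<in> set p1\<close> \<open>s \<in> set (rev q1)\<close> by blast+
    \<comment> \<open>A common vertex \<open>z\<close> other than \<open>s\<close> would let a walk
      from \<open>A\<close> to \<open>z\<close> continue to \<open>B\<close> within \<open>r\<close>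
      without \<open>s\<close>, against the choice of \<open>s\<close>.\<close>
    have cross: False if zs: "z \<noteq> s" "z \<in> set (p1' @ [s]) \<or> z \<in> set p2" "z \<in> set (s # q1') \<or> z \<in> set (rev q2)" for z
    proof -
      have "\<exists>xs. ?W A {z} xs \<and> s \<notin> set xs"
      proof (cases "z \<in> set p2")
        case True
        obtain us vs where "p2 = us @ z # vs" "?W A {z} (us @ [z])"
          by (rule walk_between_prefix[OF p(2) True])
        then show ?thesis using sn by (intro exI[of _ "us @ [z]"]) auto
      next
        case False
        then have z: "z \<in> set p1'" "z \<in> set (p1' @ [s])" using zs by auto
        obtain us vs where uv: "p1' @ [s] = us @ z # vs" "?W A {z} (us @ [z])"
          by (rule walk_between_prefix[OF p1'(1) z(2)])
        then obtain vs' where "p1' = us @ z # vs'"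
          using zs(1) by (cases vs rule: rev_cases) auto
        then show ?thesis using uv(2) p1'(2) by (intro exI[of _ "us @ [z]"]) auto
      qed
      then obtain xs where xs: "?W A {z} xs" "s \<notin> set xs" by blast
      have "\<exists>ys. ?W {z} B ys \<and> s \<notin> set ys"
      proof (cases "z \<in> set (rev q2)")
        case True
        obtain us vs where "rev q2 = us @ z # vs" "?W {z} B (z # vs)"
          by (rule walk_between_prefix[OF q(2) True])
        then show ?thesis using sn(2) by (intro exI[of _ "z # vs"]) auto
      next
        case False
        then have z: "z \<in> set q1'" "z \<in> set (s # q1')" using zs by auto
        obtain us vs where uv: "s # q1' = us @ z # vs" "?W {z} B (z # vs)"
          by (rule walk_between_prefix[OF q1'(1) z(2)])
        then obtain us' where "q1' = us' @ z # vs"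
          using zs(1) by (cases us) auto
        then show ?thesis using uv(2) q1'(2) by (intro exI[of _ "z # vs"]) auto
      qed
      then obtain ys where ys: "?W {z} B ys" "s \<notin> set ys" by blast
      have "?W A B (xs @ tl ys)" using xs ys
        by (intro walk_between_join) (auto simp: walk_between_def)
      moreover have "s \<notin> set (xs @ tl ys)" using xs ys by (cases ys) auto
      ultimately show False using s by blast
    qed
    have 1: "?W' A B (p1' @ s # q1')"
      using mono[OF walk_between_join[OF p1'(1) q1'(1)]] by simp
    \<comment> \<open>Only this second walk uses the new edge, from \<open>u\<close> to
      \<open>v\<close>; the first one passes through \<open>s\<close>.\<close>
    have 2: "?W' A B (p2 @ rev q2)"
      using mono[OF p(2)] mono[OF q(2)] e unfolding walk_between_def
      by (auto simp: successively_append_iff)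
    have "set (p1' @ s # q1') \<inter> set (p2 @ rev q2) = {}"
    proof -
      have "z \<notin> set (p2 @ rev q2)" if z: "z \<in> set (p1' @ s # q1')" for z
      proof
        assume z2: "z \<in> set (p2 @ rev q2)"
        then have "z \<noteq> s" using sn by auto
        show False
        proof (cases "z \<in> set (p1' @ [s])")
          case True
          then have "z \<notin> set p2" using p1'(3) p(3) by blast
          then have "z \<in> set (rev q2)" using z2 by auto
          then show False using cross[of z] True \<open>z \<noteq> s\<close> q1'(3) q(3) by blast
        next
          case False
          then have z1: "z \<in> set (s # q1')" using z by auto
          then have "z \<notin> set (rev q2)" using q1'(3) q(3) by blast
          then have "z \<in> set p2" using z2 by auto
          then show False using cross[of z] False \<open>z \<noteq> s\<close> z1 by blast
        qed
      qed
      then show ?thesis by blast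
    qed
    then show ?thesis using 1 2 by blast
  qed
qed

lemma menger_two:
  assumes "finite {(x, y). E x y}" "\<And>x. \<exists>xs. walk_between E A B xs \<and> x \<notin> set xs"
  obtains xs ys where "walk_between E A B xs" "distinct xs" "set xs \<inter> A = {hd xs}" "set xs \<inter> B = {last xs}"
    "walk_between E A B ys" "distinct ys" "set ys \<inter> A = {hd ys}" "set ys \<inter> B = {last ys}"
    "set xs \<inter> set ys = {}"
proof -
  obtain p q where "walk_between E A B p" "walk_between E A B q" "set p \<inter> set q = {}"
    using menger_two_rel[of "{(x, y). E x y}" A B] assms by auto
  moreover obtain p' where "walk_between E A B p'" "distinct p'" "set p' \<subseteq> set p"
    "set p' \<inter> A = {hd p'}" "set p' \<inter> B = {last p'}"
    by (rule walk_between_trim[OF \<open>walk_between E A B p\<close>])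
  moreover obtain q' where "walk_between E A B q'" "distinct q'" "set q' \<subseteq> set q"
    "set q' \<inter> A = {hd q'}" "set q' \<inter> B = {last q'}"
    by (rule walk_between_trim[OF \<open>walk_between E A B q\<close>])
  ultimately show ?thesis using that[of p' q'] by blast
qed

lemma successively_rev_symp: "symp E \<Longrightarrow> successively E (rev xs) = successively E xs"
proof -
  assume "symp E"
  then have "(\<lambda>x y. E y x) = E" by (auto intro!: ext dest: sympD)
  then show ?thesis by (simp only: successively_rev)
qed

lemma successively_join:
  "successively E (us @ [x]) \<Longrightarrow> successively E (x # vs) \<Longrightarrow> successively E (us @ x # vs)"
  by (induction us rule: induct_list012) auto

lemma successively_splitD:
  assumes "successively E (us @ x # vs)"
  shows "successively E (us @ [x])" "successively E (x # vs)"
  using assms by (induction us rule: induct_list012) auto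

section \<open>Cycles, chords and arcs\<close>

definition cyclic_path :: "('a \<Rightarrow> 'a \<Rightarrow> bool) \<Rightarrow> 'a list \<Rightarrow> bool" where
  "cyclic_path E c \<longleftrightarrow> distinct c \<and> 3 \<le> length c \<and> successively E c \<and> E (last c) (hd c)"

lemma cyclic_path_rotate: "cyclic_path E (us @ vs) \<Longrightarrow> cyclic_path E (vs @ us)"
  by (cases "us = []"; cases "vs = []") (auto simp: cyclic_path_def successively_append_iff)

text \<open>The two arcs between \<open>x\<close> and \<open>y\<close> share only their ends, so
  they count \<open>length c + 2\<close> vertices together and one has at least half of them.
  Symmetry lets the second arc be traversed backwards.\<close>

lemma cyclic_path_long_arc:
  assumes "symp E" "cyclic_path E c" "x \<in> set c" "y \<in> set c" "x \<noteq> y"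
  obtains p where "walk_between E {x} {y} p" "distinct p" "set p \<subseteq> set c" "length c + 2 \<le> 2 * length p"
proof -
  obtain us zs where c: "c = us @ x # zs" using assms by (meson split_list)
  have cy: "cyclic_path E (x # zs @ us)" using assms(2) cyclic_path_rotate[of E us "x # zs"] c by simp
  have "y \<in> set (zs @ us)" using assms c by auto
  then obtain vs ws where v: "zs @ us = vs @ y # ws" by (meson split_list)
  have cy: "cyclic_path E (x # vs @ y # ws)" using cy v by simp
  have sc: "set c = set (x # vs @ y # ws)" using c arg_cong[OF v, of set] by auto
  have lc: "length c = length vs + length ws + 2" using c arg_cong[OF v, of length] by simp
  let ?p = "x # vs @ [y]" and ?q = "x # rev ws @ [y]"
  have p: "walk_between E {x} {y} ?p" "distinct ?p" "set ?p \<subseteq> set c"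
    using cy sc by (auto simp: cyclic_path_def walk_between_def successively_append_iff successively_Cons
        hd_append split: if_splits)
  have "E x (last (y # ws))" using cy assms(1) by (auto simp: cyclic_path_def dest: sympD)
  moreover have "successively E (rev (y # ws))"
    using cy successively_rev_symp[OF assms(1), of "y # ws"]
    by (auto simp: cyclic_path_def successively_append_iff successively_Cons)
  ultimately have "successively E (x # rev (y # ws))"
    by (auto simp: successively_Cons hd_rev hd_append)
  then have q: "walk_between E {x} {y} ?q" "distinct ?q" "set ?q \<subseteq> set c"
    using cy sc by (auto simp: cyclic_path_def walk_between_def)
  show ?thesis using that[OF p] that[OF q] lc by fastforce
qed

text \<open>The chord, read backwards, closes the stretch between its ends;
  \<open>vs \<noteq> []\<close> supplies a third vertex when the chord is a single edge.\<close>

lemma path_chord_cycle: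
  assumes "symp E" "distinct (us @ x # vs @ y # ws)" "successively E (us @ x # vs @ y # ws)"
    "successively E (x # ds @ [y])" "distinct ds" "set ds \<inter> set (us @ x # vs @ y # ws) = {}" "vs \<noteq> []"
  shows "cyclic_path E (x # vs @ y # rev ds)"
  unfolding cyclic_path_def
proof (intro conjI)
  have r: "successively E ((y # rev ds) @ [x])"
    using assms(4) successively_rev_symp[OF assms(1), of "x # ds @ [y]"] by simp
  have r1: "successively E (y # rev ds)" and r2: "E (last (y # rev ds)) x"
    using iffD1[OF successively_append_iff r] by (blast, metis list.distinct(1) list.sel(1))
  show "distinct (x # vs @ y # rev ds)" using assms(2,5,6) by auto
  show "3 \<le> length (x # vs @ y # rev ds)" using assms(7) by (cases vs) auto
  have "successively E ((x # vs) @ [y])"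
    using successively_splitD(1)[of E "x # vs" y ws] successively_splitD(2)[OF assms(3)] by simp
  from successively_join[OF this r1] show "successively E (x # vs @ y # rev ds)" by simp
  show "E (last (x # vs @ y # rev ds)) (hd (x # vs @ y # rev ds))"
    using r2 by simp
qed

text \<open>With \<open>path_chord_cycle\<close> this splits a cycle along a chord into two cycles
  that jointly cover it. Here \<open>us @ ws \<noteq> []\<close> supplies the third vertex when
  \<open>ds = []\<close>.\<close>

lemma cyclic_path_replace_arc:
  assumes "cyclic_path E (us @ x # vs @ y # ws)" "successively E (x # ds @ [y])"
    "distinct ds" "set ds \<inter> set (us @ x # vs @ y # ws) = {}" "us @ ws \<noteq> []"
  shows "cyclic_path E (us @ x # ds @ y # ws)"
  unfolding cyclic_path_def
proof (intro conjI)
  have c: "distinct (us @ x # vs @ y # ws)" "successively E (us @ x # vs @ y # ws)"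
    "E (last (us @ x # vs @ y # ws)) (hd (us @ x # vs @ y # ws))"
    using assms(1) by (auto simp: cyclic_path_def)
  show "distinct (us @ x # ds @ y # ws)" using c(1) assms(3,4) by auto
  show "3 \<le> length (us @ x # ds @ y # ws)" using assms(5) by (cases us; cases ws) auto
  have "successively E (us @ [x])" "successively E (y # ws)"
    using successively_splitD[OF c(2)] successively_splitD(2)[of E "us @ x # vs" y ws] c(2) by simp_all
  then show "successively E (us @ x # ds @ y # ws)"
    using successively_join[of E "x # ds" y ws] successively_join[of E us x "ds @ y # ws"] assms(2) by simp
  show "E (last (us @ x # ds @ y # ws)) (hd (us @ x # ds @ y # ws))"
    using c(3) by (cases us) auto
qed

section \<open>Piercing a family of walks\<close>

text \<open>The least such \<open>k\<close> serves as a measure of \<open>A\<close>: it is monotone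
  and subadditive, and adding a vertex to \<open>A\<close> raises it by at most one. The piercing
  vertices may lie outside \<open>A\<close>.\<close>

definition pierced :: "'a list set \<Rightarrow> 'a set \<Rightarrow> nat \<Rightarrow> bool" where
  "pierced F A k \<longleftrightarrow> (\<exists>S. finite S \<and> card S \<le> k \<and> (\<forall>X\<in>F. set X \<inter> A \<noteq> {} \<longrightarrow> set X \<inter> S \<noteq> {}))"

lemma piercedI:
  "finite S \<Longrightarrow> card S \<le> k \<Longrightarrow>
    (\<And>X. X \<in> F \<Longrightarrow> set X \<inter> A \<noteq> {} \<Longrightarrow> set X \<inter> S \<noteq> {}) \<Longrightarrow> pierced F A k"
  unfolding pierced_def by blast

lemma not_piercedE:
  assumes "\<not> pierced F A k" "finite S" "card S \<le> k"
  obtains X where "X \<in> F" "set X \<inter> A \<noteq> {}" "set X \<inter> S = {}"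
  using assms unfolding pierced_def by blast

lemma pierced_empty [simp]: "pierced F {} k"
  by (rule piercedI[of "{}"]) auto

lemma pierced_mono:
  "pierced F A k \<Longrightarrow> (\<And>X. X \<in> F \<Longrightarrow> set X \<inter> B \<noteq> {} \<Longrightarrow> set X \<inter> A \<noteq> {}) \<Longrightarrow>
    k \<le> l \<Longrightarrow> pierced F B l"
  unfolding pierced_def by (meson le_trans)

lemma pierced_union:
  assumes "pierced F A k" "pierced F B l"
  shows "pierced F (A \<union> B) (k + l)"
proof -
  obtain S T where "finite S" "card S \<le> k" "\<forall>X\<in>F. set X \<inter> A \<noteq> {} \<longrightarrow> set X \<inter> S \<noteq> {}"
    "finite T" "card T \<le> l" "\<forall>X\<in>F. set X \<inter> B \<noteq> {} \<longrightarrow> set X \<inter> T \<noteq> {}"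
    using assms unfolding pierced_def by blast
  then show ?thesis
    by (intro piercedI[of "S \<union> T"]) (auto intro: order_trans[OF card_Un_le])
qed

lemma pierced_insert:
  assumes "pierced F A k"
  shows "pierced F (insert x A) (Suc k)"
proof -
  have "pierced F {x} 1" by (rule piercedI[of "{x}"]) auto
  from pierced_union[OF this assms] show ?thesis by simp
qed

text \<open>Discrete continuity: each further vertex raises the piercing number by at most one, so
  the shortest initial stretch that \<open>k\<close> vertices do not pierce is pierced by
  \<open>Suc k\<close>.\<close>

lemma pierced_first_segment:
  assumes "\<not> pierced F (set (drop i xs)) k"
  obtains j where "i < j" "j \<le> length xs" "\<not> pierced F (set (take (j - i) (drop i xs))) k"
    "pierced F (set (take (j - i) (drop i xs))) (Suc k)"
proof -
  let ?P = "\<lambda>m. \<not> pierced F (set (take m (drop i xs))) k"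
  have P: "?P (length (drop i xs))" using assms by simp
  define m where "m = (LEAST m. ?P m)"
  have m: "?P m" unfolding m_def using P by (rule LeastI)
  have ml: "m \<le> length (drop i xs)" unfolding m_def using P by (rule Least_le)
  have "m \<noteq> 0" using m by (cases m) auto
  then obtain m' where m': "m = Suc m'" using not0_implies_Suc by blast
  have "pierced F (set (take m' (drop i xs))) k"
    using not_less_Least[of m' ?P] m' m_def by auto
  moreover have "set (take m (drop i xs)) = insert (drop i xs ! m') (set (take m' (drop i xs)))"
    using ml m' by (auto simp: take_Suc_conv_app_nth)
  ultimately have "pierced F (set (take m (drop i xs))) (Suc k)" using pierced_insert by metis
  then show ?thesis using that[of "i + m"] m ml \<open>m \<noteq> 0\<close> by auto
qed

text \<open>Membership in \<open>U\<close> spreads forward from \<open>x\<close> along the walk;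
  symmetry of \<open>E\<close> gives the same for the reversed part before \<open>x\<close>.\<close>

lemma walk_closed:
  assumes "symp E" "successively E xs" "x \<in> set xs" "x \<in> U"
    "\<And>y z. y \<in> U \<Longrightarrow> z \<in> set xs \<Longrightarrow> E y z \<Longrightarrow> z \<in> U"
  shows "set xs \<subseteq> U"
proof -
  have up: "set (x # ys) \<subseteq> U"
    if "successively E (x # ys)" "x \<in> U" "\<And>y z. y \<in> U \<Longrightarrow> z \<in> set ys \<Longrightarrow> E y z \<Longrightarrow> z \<in> U" for x ys
    using that
  proof (induction ys arbitrary: x)
    case (Cons y ys)
    have "y \<in> U" using Cons.prems(1,2) by (intro Cons.prems(3)[of x y]) auto
    moreover have "set (y # ys) \<subseteq> U"
    proof (rule Cons.IH[OF _ \<open>y \<in> U\<close>])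
      show "successively E (y # ys)" using Cons.prems(1) by simp
      show "b \<in> U" if "a \<in> U" "b \<in> set ys" "E a b" for a b
        using that by (intro Cons.prems(3)[of a b]) auto
    qed
    ultimately show ?case using Cons.prems(2) by simp
  qed simp
  obtain us vs where e: "xs = us @ x # vs" using assms(3) by (meson split_list)
  have "successively E (us @ [x])" "successively E (x # vs)"
    using assms(2) successively_splitD[of E us x vs] e by simp_all
  then have su: "successively E (x # rev us)" "successively E (x # vs)"
    using successively_rev_symp[OF assms(1), of "us @ [x]"] by simp_all
  have cl: "set (x # ys) \<subseteq> U" if ys: "successively E (x # ys)" "set ys \<subseteq> set xs" for ys
  proof (rule up[OF ys(1) assms(4)])
    show "z \<in> U" if "y \<in> U" "z \<in> set ys" "E y z" for y z
      using assms(5)[OF that(1) _ that(3)] that(2) ys(2) by blast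
  qed
  have "set (x # vs) \<subseteq> U" "set (x # rev us) \<subseteq> U"
    using cl[OF su(1)] cl[OF su(2)] e by auto
  then show ?thesis using e by auto
qed

text \<open>The vertices reachable from \<open>x\<close> inside \<open>xs\<close> are closed under
  steps to vertices of \<open>xs\<close>, so \<open>walk_closed\<close> applies.\<close>

lemma walk_between_sub:
  assumes "symp E" "successively E xs" "x \<in> set xs" "y \<in> set xs"
  obtains p where "walk_between E {x} {y} p" "set p \<subseteq> set xs"
proof -
  define U where "U = {z. \<exists>p. walk_between E {x} {z} p \<and> set p \<subseteq> set xs}"
  have "x \<in> U" unfolding U_def using assms by (auto intro!: exI[of _ "[x]"] simp: walk_between_def)
  moreover have "z \<in> U" if yz: "y \<in> U" "z \<in> set xs" "E y z" for y z
  proof -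
    obtain p where p: "walk_between E {x} {y} p" "set p \<subseteq> set xs" using yz(1) U_def by blast
    then have "walk_between E {x} {z} (p @ [z])" "set (p @ [z]) \<subseteq> set xs" using yz
      by (auto simp: walk_between_def successively_append_iff)
    then show ?thesis unfolding U_def by blast
  qed
  ultimately have "set xs \<subseteq> U" by (rule walk_closed[OF assms(1-3)])
  then show ?thesis using that assms(4) U_def by blast
qed

lemma chord_walk_shape:
  assumes "walk_between E A B p" "distinct p" "set p \<inter> A = {hd p}" "set p \<inter> B = {last p}" "A \<inter> B = {}"
  obtains x ds y where "p = x # ds @ [y]" "x \<in> A" "y \<in> B" "set ds \<inter> (A \<union> B) = {}" "distinct ds"
    "x \<notin> set ds" "y \<notin> set ds"
proof -
  obtain x q where p: "p = x # q" using assms(1) by (cases p) (auto simp: walk_between_def)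
  have "hd p \<in> A" "last p \<in> B" using assms(1) by (auto simp: walk_between_def)
  then have "q \<noteq> []" using assms(5) p by auto
  then obtain ds y where q: "q = ds @ [y]" by (metis rev_exhaust)
  show ?thesis
  proof (rule that)
    show "p = x # ds @ [y]" using p q by simp
    show "x \<in> A" "y \<in> B" using assms(1) p q by (auto simp: walk_between_def)
    show "set ds \<inter> (A \<union> B) = {}" using assms(2-4) p q by auto
    show "distinct ds" "x \<notin> set ds" "y \<notin> set ds" using assms(2) p q by auto
  qed
qed

section \<open>Families of pairwise meeting walks that no detour lengthens\<close>

text \<open>These are the properties that longest paths and longest cycles share. A detour keeps the
  first and the last vertex, hence also the edge that closes a cycle.\<close>

locale unimprovable_walks =
  fixes V :: "'a set" and E :: "'a \<Rightarrow> 'a \<Rightarrow> bool" and F :: "'a list set"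
  assumes finV: "finite V" and symE: "symp E" and EV: "E x y \<Longrightarrow> x \<in> V"
    and F_path: "X \<in> F \<Longrightarrow> successively E X \<and> distinct X \<and> set X \<subseteq> V"
    and F_meet: "X \<in> F \<Longrightarrow> Y \<in> F \<Longrightarrow> set X \<inter> set Y \<noteq> {}"
    and no_detour: "\<lbrakk>us @ x # vs @ y # ws \<in> F; successively E (x # ps @ [y]);
      distinct (us @ x # ps @ y # ws)\<rbrakk> \<Longrightarrow> length ps \<le> length vs"
begin

lemma EV2: "E x y \<Longrightarrow> y \<in> V"
  using EV symE by (meson sympD)

lemma finE: "finite {(x, y). E x y}"
  by (rule finite_subset[of _ "V \<times> V"]) (use finV EV EV2 in auto)

text \<open>Follow \<open>X\<close> from \<open>A\<close> to a common vertex of \<open>X\<close> and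
  \<open>Y\<close>, then \<open>Y\<close> to \<open>B\<close>.\<close>

lemma link_through_members:
  assumes "X \<in> F" "Y \<in> F" "set X \<inter> A \<noteq> {}" "set Y \<inter> B \<noteq> {}"
  obtains p where "walk_between E A B p" "set p \<subseteq> set X \<union> set Y"
proof -
  obtain a b z where "a \<in> set X" "a \<in> A" "b \<in> set Y" "b \<in> B" "z \<in> set X" "z \<in> set Y"
    using assms F_meet[OF assms(1,2)] by blast
  moreover obtain p where "walk_between E {a} {z} p" "set p \<subseteq> set X"
    using walk_between_sub[OF symE _ \<open>a \<in> set X\<close> \<open>z \<in> set X\<close>] F_path[OF assms(1)] by blast
  moreover obtain q where "walk_between E {z} {b} q" "set q \<subseteq> set Y"
    using walk_between_sub[OF symE _ \<open>z \<in> set Y\<close> \<open>b \<in> set Y\<close>] F_path[OF assms(2)] by blast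
  moreover have "set (tl q) \<subseteq> set q" by (cases q) auto
  ultimately have "walk_between E {a} {b} (p @ tl q)" "set (p @ tl q) \<subseteq> set X \<union> set Y"
    using walk_between_join[of E "{a}" "{z}" p "{z}" "{b}" q]
    by (simp add: walk_between_def, auto)
  then show ?thesis using that \<open>a \<in> A\<close> \<open>b \<in> B\<close> by (meson walk_between_mono empty_subsetI insert_subset)
qed

text \<open>Two disjoint links from a cycle to nearby vertices of \<open>Q\<close> would improve \<open>Q\<close> by a detour
  along the longer arc of the cycle.\<close>

lemma no_detour_through_cycle:
  assumes Q: "Q \<in> F" and Qe: "Q = us @ y1 # vs @ y2 # ws" and c: "cyclic_path E c" "set c \<inter> set Q = {}"
    and d1: "successively E (x1 # d1 @ [y1])" "distinct d1" "set d1 \<inter> (set c \<union> set Q) = {}"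
    and d2: "successively E (x2 # d2 @ [y2])" "distinct d2" "set d2 \<inter> (set c \<union> set Q) = {}"
    and x: "x1 \<in> set c" "x2 \<in> set c" "x1 \<noteq> x2" "set d1 \<inter> set d2 = {}"
  shows "length c + 2 \<le> 2 * length vs"
proof -
  \<comment> \<open>The detour from \<open>y1\<close> to \<open>y2\<close> runs back along
    \<open>d1\<close>, through \<open>p\<close> and along \<open>d2\<close>; the arc
    \<open>p\<close> alone has at least half of \<open>length c + 2\<close> vertices.\<close>
  obtain p where p: "walk_between E {x1} {x2} p" "distinct p" "set p \<subseteq> set c" "length c + 2 \<le> 2 * length p"
    using cyclic_path_long_arc[OF symE c(1) x(1,2,3)] .
  have p': "p \<noteq> []" "hd p = x1" "last p = x2" "successively E p" using p(1) by (auto simp: walk_between_def)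
  have "successively E ((y1 # rev d1) @ [x1])"
    using successively_rev_symp[OF symE, of "x1 # d1 @ [y1]"] d1(1) by simp
  moreover have "successively E p" "p = x1 # tl p" using p' by auto
  ultimately have 1: "successively E ((y1 # rev d1) @ p)"
    using successively_join[of E "y1 # rev d1" x1 "tl p"] by metis
  moreover have "(y1 # rev d1) @ p = ((y1 # rev d1) @ butlast p) @ [x2]"
    using p' by (metis append_assoc append_butlast_last_id)
  ultimately have "successively E (((y1 # rev d1) @ butlast p) @ x2 # d2 @ [y2])"
    using successively_join[of E "(y1 # rev d1) @ butlast p" x2 "d2 @ [y2]"] d2(1) by metis
  moreover have "((y1 # rev d1) @ butlast p) @ x2 # d2 @ [y2] = y1 # (rev d1 @ p @ d2) @ [y2]"
    using p' by (metis append.assoc append_Cons append_butlast_last_id append_Nil)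
  ultimately have "successively E (y1 # (rev d1 @ p @ d2) @ [y2])" by metis
  moreover have "distinct (us @ y1 # (rev d1 @ p @ d2) @ y2 # ws)"
    using F_path[OF Q] d1(2,3) d2(2,3) c(2) p(2,3) x(4) unfolding Qe by auto
  ultimately have "length (rev d1 @ p @ d2) \<le> length vs" by (rule no_detour[OF Q[unfolded Qe]])
  then show ?thesis using p(4) by simp
qed

text \<open>Cut \<open>Q\<close> into \<open>b\<close> blocks of at most \<open>h\<close> vertices.
  If no single vertex met all links from \<open>c\<close> to a block that avoid the rest of
  \<open>Q\<close>, Menger's theorem would give two disjoint ones, contradicting
  \<open>no_detour_through_cycle\<close>. The resulting cut vertices, one per block, pierce every
  member meeting \<open>c\<close>: it meets \<open>Q\<close> too, so it contains a link whose only
  vertex on \<open>Q\<close> is its end.\<close>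

lemma cycle_avoided:
  assumes c: "cyclic_path E c" and Q: "Q \<in> F" "set c \<inter> set Q = {}" and
    h: "2 * h \<le> length c + 4" "length Q \<le> b * h" "\<not> pierced F (set c) b"
  shows False
proof -
  define blk where "blk i = take h (drop (i * h) Q)" for i
  have blk_split: "Q = take (i * h) Q @ blk i @ drop (h + i * h) Q" for i
    unfolding blk_def by (metis append_take_drop_id drop_drop)
  have blk_sub: "set (blk i) \<subseteq> set Q" for i
    unfolding blk_def by (meson set_drop_subset set_take_subset subset_trans)
  have blk_cover: "\<exists>i<b. q \<in> set (blk i)" if "q \<in> set Q" for q
  proof -
    obtain n where n: "n < length Q" "Q ! n = q" using \<open>q \<in> set Q\<close> by (meson in_set_conv_nth)
    then have "h > 0" using h(2) by (cases h) auto
    have "n div h < b" using n(1) h(2) by (simp add: less_mult_imp_div_less)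
    moreover have "n mod h < length (blk (n div h))"
      using n(1) \<open>h > 0\<close> unfolding blk_def by (simp add: less_diff_conv2 less_diff_conv add.commute)
    moreover have "blk (n div h) ! (n mod h) = q"
    proof -
      have "n div h * h \<le> length Q" using n(1) div_times_less_eq_dividend[of n h] by linarith
      then show ?thesis using n \<open>h > 0\<close> unfolding blk_def by simp
    qed
    ultimately show ?thesis by (metis nth_mem)
  qed
  have "\<exists>x. \<forall>p. walk_between E (set c) (set (blk i)) p \<and> set p \<inter> (set Q - set (blk i)) = {} \<longrightarrow> x \<in> set p" for i
  proof (rule ccontr)
    assume no: "\<not> ?thesis"
    \<comment> \<open>Deleting the vertices of \<open>Q\<close> outside the block makes Menger's
      theorem produce links that avoid them.\<close>
    define E' where "E' x y \<longleftrightarrow> E x y \<and> x \<notin> set Q - set (blk i) \<and> y \<notin> set Q - set (blk i)" for x y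
    have E'w: "walk_between E' A B p" if "walk_between E A B p" "set p \<inter> (set Q - set (blk i)) = {}" for A B p
      using that unfolding walk_between_def E'_def by (auto elim!: successively_mono)
    have wE': "walk_between E A B p" if "walk_between E' A B p" for A B p
      using that unfolding walk_between_def E'_def by (auto elim!: successively_mono)
    \<comment> \<open>Every vertex but the last has an outgoing step of \<open>E'\<close>; the last
      one lies in the block, which also settles one-vertex walks.\<close>
    have avoid: "set p \<inter> (set Q - set (blk i)) = {}" if "walk_between E' (set c) (set (blk i)) p" for p
    proof -
      have "successively E' p" "last p \<in> set (blk i)" "p \<noteq> []" using that by (auto simp: walk_between_def)
      then show ?thesis
        by (induction p rule: induct_list012) (auto simp: E'_def)
    qed
    have "finite {(x, y). E' x y}" by (rule finite_subset[OF _ finE]) (auto simp: E'_def)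
    moreover have "\<exists>xs. walk_between E' (set c) (set (blk i)) xs \<and> x \<notin> set xs" for x
      using no E'w by blast
    ultimately obtain p q where p: "walk_between E' (set c) (set (blk i)) p" "distinct p"
      "set p \<inter> set c = {hd p}" "set p \<inter> set (blk i) = {last p}"
      and q: "walk_between E' (set c) (set (blk i)) q" "distinct q"
      "set q \<inter> set c = {hd q}" "set q \<inter> set (blk i) = {last q}"
      and pq: "set p \<inter> set q = {}"
      by (rule menger_two)
    have cb: "set c \<inter> set (blk i) = {}" using Q(2) blk_sub by blast
    obtain x1 d1 y1 where d1: "p = x1 # d1 @ [y1]" "x1 \<in> set c" "y1 \<in> set (blk i)"
      "set d1 \<inter> (set c \<union> set (blk i)) = {}" "distinct d1"
      using chord_walk_shape[OF wE'[OF p(1)] p(2-4) cb] by metis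
    obtain x2 d2 y2 where d2: "q = x2 # d2 @ [y2]" "x2 \<in> set c" "y2 \<in> set (blk i)"
      "set d2 \<inter> (set c \<union> set (blk i)) = {}" "distinct d2"
      using chord_walk_shape[OF wE'[OF q(1)] q(2-4) cb] by metis
    have s: "successively E p" "successively E q" using wE'[OF p(1)] wE'[OF q(1)] by (auto simp: walk_between_def)
    have d1Q: "set d1 \<inter> (set c \<union> set Q) = {}" using avoid[OF p(1)] d1(1,4) by auto
    have d2Q: "set d2 \<inter> (set c \<union> set Q) = {}" using avoid[OF q(1)] d2(1,4) by auto
    have xx: "x1 \<noteq> x2" "x2 \<noteq> x1" "set d1 \<inter> set d2 = {}" "set d2 \<inter> set d1 = {}"
      using pq d1(1) d2(1) by auto
    have s: "successively E (x1 # d1 @ [y1])" "successively E (x2 # d2 @ [y2])" using s d1(1) d2(1) by simp_all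
    have far: "length c + 2 \<le> 2 * length vs" if "blk i = us @ y1 # vs @ y2 # ws" for us vs ws
      by (rule no_detour_through_cycle[OF Q(1) _ c Q(2) s(1) d1(5) d1Q s(2) d2(5) d2Q d1(2) d2(2) xx(1,3),
          of "take (i*h) Q @ us" _ "ws @ drop (h + i*h) Q"]) (use blk_split[of i] that in simp)
    have far': "length c + 2 \<le> 2 * length vs" if "blk i = us @ y2 # vs @ y1 # ws" for us vs ws
      by (rule no_detour_through_cycle[OF Q(1) _ c Q(2) s(2) d2(5) d2Q s(1) d1(5) d1Q d2(2) d1(2) xx(2,4),
          of "take (i*h) Q @ us" _ "ws @ drop (h + i*h) Q"]) (use blk_split[of i] that in simp)
    \<comment> \<open>At most \<open>h - 2\<close> vertices of the block lie between
      \<open>y1\<close> and \<open>y2\<close>, while \<open>far\<close> and \<open>far'\<close>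
      demand at least \<open>h - 1\<close>.\<close>
    have lb: "length (blk i) \<le> h" unfolding blk_def by simp
    obtain us zs where 1: "blk i = us @ y1 # zs" using d1(3) by (meson split_list)
    have "y2 \<noteq> y1" using pq d1(1) d2(1) by auto
    then consider "y2 \<in> set zs" | "y2 \<in> set us" using 1 d2(3) by auto
    then show False
    proof cases
      case 1
      then obtain vs ws where "zs = vs @ y2 # ws" by (meson split_list)
      then show False using far \<open>blk i = us @ y1 # zs\<close> lb h(1) by fastforce
    next
      case 2
      then obtain vs ws where "us = vs @ y2 # ws" by (meson split_list)
      then show False using far' \<open>blk i = us @ y1 # zs\<close> lb h(1) by fastforce
    qed
  qed
  then obtain cut where cut: "\<And>i p. walk_between E (set c) (set (blk i)) p \<Longrightarrow>
    set p \<inter> (set Q - set (blk i)) = {} \<Longrightarrow> cut i \<in> set p" by metis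
  have "card (cut ` {..<b}) \<le> b" using card_image_le[of "{..<b}" cut] by simp
  then obtain X where X: "X \<in> F" "set X \<inter> set c \<noteq> {}" "set X \<inter> cut ` {..<b} = {}"
    using not_piercedE[OF h(3)] by blast
  obtain p where p: "walk_between E (set c) (set Q) p" "set p \<subseteq> set X" "set p \<inter> set Q = {last p}"
  proof -
    obtain x y where "x \<in> set X" "x \<in> set c" "y \<in> set X" "y \<in> set Q"
      using X(2) F_meet[OF X(1) Q(1)] by blast
    then obtain p where "walk_between E {x} {y} p" "set p \<subseteq> set X"
      using walk_between_sub[OF symE] F_path[OF X(1)] by metis
    then have "walk_between E (set c) (set Q) p"
      using \<open>x \<in> set c\<close> \<open>y \<in> set Q\<close> by (auto simp: walk_between_def)
    then show ?thesis using walk_between_trim[of E "set c" "set Q" p] that \<open>set p \<subseteq> set X\<close>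
      by (metis subset_trans)
  qed
  obtain i where i: "i < b" "last p \<in> set (blk i)" using blk_cover p(3) by blast
  have "walk_between E (set c) (set (blk i)) p" using p(1) i(2) by (auto simp: walk_between_def)
  moreover have "set p \<inter> set Q \<subseteq> set (blk i)" using p(3) i(2) by simp
  then have "set p \<inter> (set Q - set (blk i)) = {}" by blast
  ultimately have "cut i \<in> set p" by (rule cut)
  then show False using X(3) p(2) i(1) by blast
qed

section \<open>Finding a cycle that needs many vertices\<close>

text \<open>The vertices that pierce all members meeting \<open>A\<close> miss some member meeting
  \<open>B\<close>; that member cannot meet \<open>A\<close>.\<close>

lemma member_avoiding:
  assumes "pierced F A m" "\<not> pierced F B m"
  obtains X where "X \<in> F" "set X \<inter> A = {}" "set X \<inter> B \<noteq> {}"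
  using assms pierced_def by (metis (no_types, lifting))

text \<open>Every member meets \<open>P\<close>, so piercing the members that meet \<open>P\<close>
  pierces all of \<open>F\<close>.\<close>

lemma pierced_by_member:
  assumes "P \<in> F" "pierced F (set P) m"
  shows "pierced F B m"
  by (rule pierced_mono[OF assms(2)]) (use F_meet assms(1) in auto)

lemma pierced_card: "finite A \<Longrightarrow> card A \<le> m \<Longrightarrow> pierced F A m"
  by (rule piercedI[of A]) auto

text \<open>A window sliding along a path \<open>P\<close> of \<open>F\<close>: members avoiding the window meet \<open>P\<close> after
  it at the start and before it at the end, and at some position both kinds exist; together they
  supply a chord across the window.\<close>

lemma not_pierced_cycle_exists:
  assumes P: "P \<in> F" and np: "\<not> pierced F (set P) (2 * Suc k)"
  obtains c where "cyclic_path E c" "\<not> pierced F (set c) k"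
proof -
  define seg where "seg i j = set (take (j - i) (drop i P))" for i j
  \<comment> \<open>The window is large enough that a cycle through it is not pierced by
    \<open>k\<close>, yet small enough that members avoid it.\<close>
  define good where "good i \<longleftrightarrow> (\<exists>j X. i < j \<and> j \<le> length P \<and> \<not> pierced F (seg i j) k \<and>
    pierced F (seg i j) (Suc k) \<and> X \<in> F \<and> set X \<inter> seg i j = {} \<and> set X \<inter> set (drop j P) \<noteq> {})" for i
  have np': "\<not> pierced F (set P) m" if "m \<le> 2 * Suc k" for m
    using np pierced_mono[of F "set P" m "set P"] that by blast
  have drop_seg: "set (drop i P) = seg i j \<union> set (drop j P)" if "i \<le> j" for i j
  proof -
    have "drop i P = take (j - i) (drop i P) @ drop j P"
      using that by (metis append_take_drop_id drop_drop le_add_diff_inverse2)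
    then show ?thesis unfolding seg_def by (metis set_append)
  qed
  have "good 0"
  proof -
    obtain j where j: "0 < j" "j \<le> length P" "\<not> pierced F (seg 0 j) k" "pierced F (seg 0 j) (Suc k)"
      using pierced_first_segment[of F 0 P k] np'[of k] unfolding seg_def by auto
    have "\<not> pierced F (set P) (Suc k)" using np' by simp
    then obtain X where X: "X \<in> F" "set X \<inter> seg 0 j = {}"
      by (rule member_avoiding[OF j(4)])
    have "set X \<inter> set (drop j P) \<noteq> {}" using F_meet[OF X(1) P] drop_seg[of 0 j] X(2) by auto
    then show ?thesis unfolding good_def using j X by blast
  qed
  moreover have "\<not> good (length P)" unfolding good_def by auto
  ultimately obtain i where "good i" and ng: "\<not> good (Suc i)"
    using nat_induct[of good "length P"] by blast
  then obtain j X where j: "i < j" "j \<le> length P" "\<not> pierced F (seg i j) k" "pierced F (seg i j) (Suc k)"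
    and X: "X \<in> F" "set X \<inter> seg i j = {}" "set X \<inter> set (drop j P) \<noteq> {}" unfolding good_def by blast
  have Pi: "P ! i \<in> seg i j" unfolding seg_def
    using j(1,2) by (auto simp: in_set_conv_nth intro!: exI[of _ 0])
  have Psplit: "set P = set (take i P) \<union> {P ! i} \<union> set (drop (Suc i) P)"
    using id_take_nth_drop[of i P] j(1,2) by (metis Un_insert_right le_less_trans less_le_trans
      list.simps(15) set_append sup_bot.right_neutral Un_insert_left)
  \<comment> \<open>Otherwise every member avoiding this window meets \<open>P\<close> after
    position \<open>i\<close>. Then the rest of \<open>P\<close> still contains a window starting at
    \<open>Suc i\<close>; some member avoids both windows, as \<open>P\<close> is not pierced by
    \<open>2 * Suc k\<close>, and it makes \<open>Suc i\<close> good.\<close>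
  have "\<exists>Y\<in>F. set Y \<inter> seg i j = {} \<and> set Y \<inter> set (take i P) \<noteq> {}"
  proof (rule ccontr)
    assume "\<not> ?thesis"
    then have no: "set Y \<inter> set (take i P) = {}" if "Y \<in> F" "set Y \<inter> seg i j = {}" for Y
      using that by blast
    have after: "set Y \<inter> set (drop (Suc i) P) \<noteq> {}" if "Y \<in> F" "set Y \<inter> seg i j = {}" for Y
      using no[OF that] F_meet[OF that(1) P] Psplit Pi that(2) by auto
    have "\<not> pierced F (set (drop (Suc i) P)) k"
    proof
      assume "pierced F (set (drop (Suc i) P)) k"
      from pierced_union[OF j(4) this] have "pierced F (set P) (Suc k + k)"
        by (rule pierced_mono) (use after in auto)
      then show False using np' by simp
    qed
    then obtain j' where j': "Suc i < j'" "j' \<le> length P" "\<not> pierced F (seg (Suc i) j') k"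
      "pierced F (seg (Suc i) j') (Suc k)"
      using pierced_first_segment[of F "Suc i" P k] unfolding seg_def by auto
    have "pierced F (seg i j \<union> seg (Suc i) j') (2 * Suc k)"
      using pierced_union[OF j(4) j'(4)] by (simp add: mult_2)
    then obtain Y where Y: "Y \<in> F" "set Y \<inter> (seg i j \<union> seg (Suc i) j') = {}"
      using member_avoiding[OF _ np] by metis
    have "set Y \<inter> set (drop j' P) \<noteq> {}"
      using after[OF Y(1)] Y(2) drop_seg[of "Suc i" j'] j'(1) by auto
    then have "good (Suc i)" unfolding good_def using j' Y by blast
    then show False using ng by simp
  qed
  then obtain Y where Y: "Y \<in> F" "set Y \<inter> seg i j = {}" "set Y \<inter> set (take i P) \<noteq> {}" by blast
  obtain p where p: "walk_between E (set (take i P)) (set (drop j P)) p" "set p \<subseteq> set Y \<union> set X"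
    using link_through_members[OF Y(1) X(1) Y(3) X(3)] .
  obtain p' where p': "walk_between E (set (take i P)) (set (drop j P)) p'" "distinct p'" "set p' \<subseteq> set p"
    "set p' \<inter> set (take i P) = {hd p'}" "set p' \<inter> set (drop j P) = {last p'}"
    by (rule walk_between_trim[OF p(1)])
  have dP: "distinct P" "successively E P" using F_path[OF P] by auto
  have disj: "set (take i P) \<inter> set (drop j P) = {}"
    using dP(1) j(1) by (simp add: set_take_disj_set_drop_if_distinct)
  obtain x ds y where d: "p' = x # ds @ [y]" "x \<in> set (take i P)" "y \<in> set (drop j P)"
    "set ds \<inter> (set (take i P) \<union> set (drop j P)) = {}" "distinct ds"
    using chord_walk_shape[OF p'(1,2,4,5) disj] by metis
  obtain us vs1 where uv: "take i P = us @ x # vs1" using d(2) by (meson split_list)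
  obtain vs2 ws where vw: "drop j P = vs2 @ y # ws" using d(3) by (meson split_list)
  define M where "M = take (j - i) (drop i P)"
  have "P = take i P @ M @ drop j P" unfolding M_def
    using j(1) by (metis append_take_drop_id drop_drop le_add_diff_inverse2 less_imp_le_nat)
  then have Pe: "P = us @ x # (vs1 @ M @ vs2) @ y # ws" using uv vw by simp
  have M: "set M = seg i j" "M \<noteq> []" using Pi unfolding M_def seg_def by auto
  \<comment> \<open>The link stays in \<open>X\<close> and \<open>Y\<close>, which avoid the window,
    so it is a chord of \<open>P\<close>; the cycle that it closes contains the whole
    window.\<close>
  have "set ds \<inter> seg i j = {}" using p'(3) p(2) d(1) X(2) Y(2) by auto
  moreover have "set P = set (take i P) \<union> seg i j \<union> set (drop j P)"
    using \<open>P = take i P @ M @ drop j P\<close> M(1) by (metis set_append Un_assoc)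
  ultimately have "set ds \<inter> set P = {}" using d(4) by blast
  then have "cyclic_path E (x # (vs1 @ M @ vs2) @ y # rev ds)"
    using dP d(1,5) p'(1) M(2) Pe
    by (intro path_chord_cycle[OF symE, of us]) (auto simp: walk_between_def)
  moreover have "\<not> pierced F (set (x # (vs1 @ M @ vs2) @ y # rev ds)) k"
  proof
    assume "pierced F (set (x # (vs1 @ M @ vs2) @ y # rev ds)) k"
    then have "pierced F (seg i j) k" by (rule pierced_mono) (use M in auto)
    then show False using j(3) by simp
  qed
  ultimately show ?thesis by (rule that)
qed

section \<open>Isometry of a shortest cycle that needs many vertices\<close>

text \<open>The chord splits \<open>c\<close> into two cycles that jointly cover it. Were both
  shorter than \<open>c\<close>, each would be pierced by \<open>t\<close> vertices and
  \<open>c\<close> by \<open>2 * t\<close>. The alternatives say which of the two is not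
  shorter.\<close>

lemma chord_of_minimal_cycle:
  assumes c: "cyclic_path E c"
    and min: "\<And>d. cyclic_path E d \<Longrightarrow> length d < length c \<Longrightarrow> pierced F (set d) t"
    and np: "\<not> pierced F (set c) (2 * t)"
    and ij: "i < j" "j < length c" and ds: "successively E (c ! i # ds @ [c ! j])" "distinct ds" "set ds \<inter> set c = {}"
  shows "j - i \<le> length ds + 1 \<or> length c \<le> j - i + length ds + 1"
proof (rule ccontr)
  assume neg: "\<not> ?thesis"
  define us where "us = take i c"
  define vs where "vs = take (j - i - 1) (drop (Suc i) c)"
  define ws where "ws = drop (Suc j) c"
  have "drop (Suc i) c = vs @ drop j c" unfolding vs_def
    using ij by (metis append_take_drop_id drop_drop Suc_leI diff_diff_left le_add_diff_inverse2 plus_1_eq_Suc add.commute)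
  moreover have "drop j c = c ! j # ws" unfolding ws_def using ij by (simp add: Cons_nth_drop_Suc)
  ultimately have ce: "c = us @ c ! i # vs @ c ! j # ws"
    using id_take_nth_drop[of i c] ij unfolding us_def by simp
  have len: "length us = i" "length vs = j - i - 1" "length ws = length c - Suc j"
    unfolding us_def vs_def ws_def using ij by auto
  define x where "x = c ! i"
  define y where "y = c ! j"
  note ce = ce[folded x_def y_def] and ds = ds[folded x_def y_def]
  have c': "cyclic_path E (us @ x # vs @ y # ws)" using c ce by simp
  have ds': "set ds \<inter> set (us @ x # vs @ y # ws) = {}" using ds(3) ce by simp
  have d: "distinct (us @ x # vs @ y # ws)" "successively E (us @ x # vs @ y # ws)"
    using c' unfolding cyclic_path_def by blast+
  \<comment> \<open>The negated bounds exclude that \<open>x\<close> and \<open>y\<close> are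
    neighbours on \<open>c\<close>, inside the list or across its ends.\<close>
  have "vs \<noteq> []" "us @ ws \<noteq> []" using neg len ij by auto
  have "pierced F (set (x # vs @ y # rev ds)) t"
  proof (intro min path_chord_cycle[OF symE d ds(1,2) ds' \<open>vs \<noteq> []\<close>])
    show "length (x # vs @ y # rev ds) < length c" using neg len ij by (simp; arith)
  qed
  moreover have "pierced F (set (us @ x # ds @ y # ws)) t"
  proof (intro min cyclic_path_replace_arc[OF c' ds(1,2) ds' \<open>us @ ws \<noteq> []\<close>])
    show "length (us @ x # ds @ y # ws) < length c" using neg len ij by (simp; arith)
  qed
  ultimately have "pierced F (set (x # vs @ y # rev ds) \<union> set (us @ x # ds @ y # ws)) (2 * t)"
    using pierced_union by (metis mult_2)
  then have "pierced F (set c) (2 * t)"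
    by (rule pierced_mono) (subst (asm) ce, auto)
  then show False using np by simp
qed

text \<open>One of the two arcs between the ends has at most as many edges as \<open>xs\<close>. A
  walk with a repeated vertex is shortened, one that visits \<open>c\<close> in between is split
  there, and what remains is a single vertex or a chord.\<close>

lemma minimal_cycle_isometric:
  assumes c: "cyclic_path E c"
    and min: "\<And>d. cyclic_path E d \<Longrightarrow> length d < length c \<Longrightarrow> pierced F (set d) t"
    and np: "\<not> pierced F (set c) (2 * t)"
    and ij: "i < length c" "j < length c" and xs: "walk_between E {c ! i} {c ! j} xs"
  shows "\<bar>int i - int j\<bar> < int (length xs) \<or> int (length c) < \<bar>int i - int j\<bar> + int (length xs)"
  using ij xs
proof (induction "length xs" arbitrary: xs i j rule: less_induct)
  case less
  have xs: "xs \<noteq> []" "successively E xs" "hd xs = c ! i" "last xs = c ! j"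
    using less.prems by (auto simp: walk_between_def)
  have dc: "distinct c" using c by (simp add: cyclic_path_def)
  consider "\<not> distinct xs" | "distinct xs" "\<exists>ps z qs. xs = ps @ z # qs \<and> ps \<noteq> [] \<and> qs \<noteq> [] \<and> z \<in> set c"
    | "distinct xs" "\<And>ps z qs. xs = ps @ z # qs \<Longrightarrow> ps \<noteq> [] \<Longrightarrow> qs \<noteq> [] \<Longrightarrow> z \<notin> set c" by blast
  then show ?case
  proof cases
    case 1
    obtain ys where ys: "walk_between E {c ! i} {c ! j} ys" "distinct ys" "set ys \<subseteq> set xs"
      by (rule walk_between_trim[OF less.prems(3)])
    have "card (set xs) < length xs" using 1 by (metis card_distinct card_length le_neq_implies_less)
    moreover have "length ys \<le> card (set xs)"
      using ys(2,3) by (metis List.finite_set card_mono distinct_card)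
    ultimately show ?thesis using less.hyps[OF _ less.prems(1,2) ys(1)] by fastforce
  next
    case 2
    then obtain ps z qs where e: "xs = ps @ z # qs" "ps \<noteq> []" "qs \<noteq> []" "z \<in> set c" by blast
    then obtain l where l: "l < length c" "z = c ! l" by (metis in_set_conv_nth)
    have "successively E (ps @ [z])" "successively E (z # qs)"
      using successively_splitD[of E ps z qs] xs(2) e(1) by simp_all
    then have "walk_between E {c ! i} {c ! l} (ps @ [z])" "walk_between E {c ! l} {c ! j} (z # qs)"
      using xs e l by (auto simp: walk_between_def)
    \<comment> \<open>Triangle inequality for the distance on the cycle; the vertex
      \<open>c ! l\<close> is counted in both parts.\<close>
    then have "\<bar>int i - int l\<bar> < int (length (ps @ [z])) \<or> int (length c) < \<bar>int i - int l\<bar> + int (length (ps @ [z]))"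
      "\<bar>int l - int j\<bar> < int (length (z # qs)) \<or> int (length c) < \<bar>int l - int j\<bar> + int (length (z # qs))"
      using less.hyps[of "ps @ [z]" i l] less.hyps[of "z # qs" l j] less.prems(1,2) l(1) e by auto
    moreover have "int (length xs) = int (length ps) + int (length qs) + 1" using e by simp
    ultimately show ?thesis using l(1) less.prems(1,2) by (simp; linarith)
  next
    case 3
    show ?thesis
    proof (cases "tl xs = []")
      case True
      then have "c ! i = c ! j" using xs by (cases xs) auto
      then have "i = j" using dc less.prems(1,2) nth_eq_iff_index_eq by blast
      then show ?thesis using xs(1) by simp
    next
      case False
      then obtain ds where ds: "xs = c ! i # ds @ [c ! j]"
        using xs by (metis append_butlast_last_id last_tl list.collapse)
      have "z \<notin> set c" if zd: "z \<in> set ds" for z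
      proof -
        obtain ps qs where "ds = ps @ z # qs" using zd by (meson split_list)
        then show ?thesis using ds by (intro 3(2)[of "c ! i # ps" z "qs @ [c ! j]"]) auto
      qed
      then have dsc: "set ds \<inter> set c = {}" by blast
      have dd: "distinct ds" "c ! i \<noteq> c ! j" using 3(1) ds by auto
      then consider "i < j" | "j < i" by (metis linorder_neqE_nat)
      then show ?thesis
      proof cases
        case 1
        then show ?thesis
          using chord_of_minimal_cycle[OF c min np 1 less.prems(2) _ dd(1) dsc] xs(2) ds by auto
      next
        case 2
        have "successively E (c ! j # rev ds @ [c ! i])"
          using xs(2) ds successively_rev_symp[OF symE, of xs] by simp
        then show ?thesis
          using chord_of_minimal_cycle[OF c min np 2 less.prems(1), of "rev ds"] dd(1) dsc ds 2 by auto
      qed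
    qed
  qed
qed

section \<open>Growth of breadth-first balls\<close>

primrec ball :: "'a set \<Rightarrow> nat \<Rightarrow> 'a set" where
  "ball A 0 = A"
| "ball A (Suc n) = ball A n \<union> {y. \<exists>x\<in>ball A n. E x y}"

lemma ball_walk:
  assumes "v \<in> ball A n"
  obtains xs where "walk_between E A {v} xs" "length xs \<le> Suc n"
proof -
  have "\<exists>xs. walk_between E A {v} xs \<and> length xs \<le> Suc n" using assms
  proof (induction n arbitrary: v)
    case 0
    then show ?case by (intro exI[of _ "[v]"]) (auto simp: walk_between_def)
  next
    case (Suc n)
    show ?case
    proof (cases "v \<in> ball A n")
      case True
      then show ?thesis using Suc.IH by (meson le_Suc_eq)
    next
      case False
      then obtain x where x: "x \<in> ball A n" "E x v" using Suc.prems by auto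
      then obtain xs where "walk_between E A {x} xs" "length xs \<le> Suc n" using Suc.IH by blast
      then show ?thesis using x(2)
        by (intro exI[of _ "xs @ [v]"]) (auto simp: walk_between_def successively_append_iff)
    qed
  qed
  then show ?thesis using that by blast
qed

lemma ball_mono: "A \<subseteq> ball A n"
  by (induction n) auto

lemma ball_subset: "A \<subseteq> V \<Longrightarrow> ball A n \<subseteq> V"
  by (induction n) (auto intro: EV2)

text \<open>If \<open>t\<close> vertices sufficed for the layer, members meeting \<open>A\<close>
  and \<open>B\<close> would avoid it. The first is confined to the inner ball; the second meets the
  first, so it is confined there as well and misses \<open>B\<close>.\<close>

lemma layer_card:
  assumes "A \<subseteq> V" "\<not> pierced F A t" "\<not> pierced F B t" "ball A (Suc n) \<inter> B = {}"
  shows "t < card (ball A (Suc n) - ball A n)"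
proof (rule ccontr)
  let ?S = "ball A (Suc n) - ball A n"
  assume "\<not> ?thesis"
  then have S: "finite ?S" "card ?S \<le> t"
    using finite_subset[OF ball_subset[OF assms(1)] finV] by (blast, linarith)
  obtain X where X: "X \<in> F" "set X \<inter> A \<noteq> {}" "set X \<inter> ?S = {}" using not_piercedE[OF assms(2) S] .
  obtain Y where Y: "Y \<in> F" "set Y \<inter> B \<noteq> {}" "set Y \<inter> ?S = {}" using not_piercedE[OF assms(3) S] .
  have inner: "set Z \<subseteq> ball A n" if Z: "Z \<in> F" "set Z \<inter> ball A n \<noteq> {}" "set Z \<inter> ?S = {}" for Z
  proof -
    obtain z where z: "z \<in> set Z" "z \<in> ball A n" using Z(2) by blast
    show ?thesis
    proof (rule walk_closed[OF symE _ z])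
      show "successively E Z" using F_path[OF Z(1)] by blast
      show "w \<in> ball A n" if "y \<in> ball A n" "w \<in> set Z" "E y w" for y w
        using that Z(3) by auto
    qed
  qed
  have "set X \<subseteq> ball A n" using inner[OF X(1) _ X(3)] X(2) ball_mono by blast
  then have "set Y \<subseteq> ball A n" using inner[OF Y(1) _ Y(3)] F_meet[OF X(1) Y(1)] by blast
  then show False using Y(2) assms(4) by auto
qed

text \<open>Each layer adds at least \<open>Suc t\<close> vertices; the inequality is strict because
  \<open>A\<close> itself is nonempty.\<close>

lemma ball_card:
  assumes "A \<subseteq> V" "\<not> pierced F A t" "\<not> pierced F B t" "ball A n \<inter> B = {}"
  shows "n * Suc t < card (ball A n)"
  using assms(4)
proof (induction n)
  case 0
  have "A \<noteq> {}" using assms(2) by auto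
  then show ?case using finite_subset[OF assms(1) finV] by (simp add: card_gt_0_iff)
next
  case (Suc n)
  have "card (ball A (Suc n)) = card (ball A n) + card (ball A (Suc n) - ball A n)"
  proof -
    have fin: "finite (ball A m)" for m using finite_subset[OF ball_subset[OF assms(1)] finV] .
    have sub: "ball A n \<subseteq> ball A (Suc n)" by simp
    show ?thesis using card_Diff_subset[OF fin sub] card_mono[OF fin sub] by simp
  qed
  moreover have "ball A n \<inter> B = {}" using Suc.prems by auto
  ultimately show ?case using Suc.IH layer_card[OF assms(1-3) Suc.prems] by simp
qed

section \<open>The square-root bound\<close>

theorem pierced_sqrt:
  assumes K: "0 < K" "card V \<le> K * K"
  shows "pierced F UNIV (4 * K)"
proof (rule ccontr)
  assume np: "\<not> pierced F UNIV (4 * K)"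
  then obtain P where P: "P \<in> F" using not_piercedE[OF np, of "{}"] by auto
  \<comment> \<open>All members meet \<open>P\<close>, so \<open>P\<close> is as hard to pierce as
    \<open>F\<close>; the bound is \<open>4 * K\<close> since \<open>K\<close> is positive.\<close>
  have "\<not> pierced F (set P) (2 * Suc (2 * K - 1))" using np pierced_by_member[OF P] K(1) by auto
  then obtain c0 where c0: "cyclic_path E c0 \<and> \<not> pierced F (set c0) (2 * K - 1)"
    using not_pierced_cycle_exists[OF P] by metis
  obtain c where c: "cyclic_path E c" "\<not> pierced F (set c) (2 * K - 1)"
    and "\<And>d. cyclic_path E d \<and> \<not> pierced F (set d) (2 * K - 1) \<Longrightarrow> length c \<le> length d"
    using ex_has_least_nat[of "\<lambda>c. cyclic_path E c \<and> \<not> pierced F (set c) (2 * K - 1)" c0 length] c0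
    by blast
  then have min: "\<And>d. cyclic_path E d \<Longrightarrow> length d < length c \<Longrightarrow> pierced F (set d) (2 * K - 1)"
    by (meson not_less)
  have len: "2 * K \<le> length c"
    using pierced_card[of "set c" "2 * K - 1"] c(2) card_length[of c] by force
  \<comment> \<open>With \<open>h = K\<close>, a number of \<open>2 * K - 1\<close> blocks covers
    \<open>Q\<close>, since \<open>K * K \<le> (2 * K - 1) * K\<close>.\<close>
  have meets: "set Q \<inter> set c \<noteq> {}" if Q: "Q \<in> F" for Q
  proof
    assume "set Q \<inter> set c = {}"
    have "length Q \<le> card V"
      using F_path[OF Q] by (metis card_mono distinct_card finV)
    also have "\<dots> \<le> (2 * K - 1) * K" using K by (auto intro: order_trans[OF K(2)] mult_le_mono1)
    finally show False
      using cycle_avoided[OF c(1) Q, of K "2 * K - 1"] c(2) len \<open>set Q \<inter> set c = {}\<close> by auto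
  qed
  have npc: "\<not> pierced F (set c) m" if "m \<le> 4 * K" for m
    using np pierced_mono[of F "set c" m UNIV "4 * K"] meets that by blast
  define k where "k = K - 1"
  have Kk: "K = Suc k" using K unfolding k_def by simp
  define seg where "seg i j = set (take (j - i) (drop i c))" for i j
  have drop_seg: "set (drop i c) = seg i j \<union> set (drop j c)" if "i \<le> j" for i j
  proof -
    have "drop i c = take (j - i) (drop i c) @ drop j c"
      using that by (metis append_take_drop_id drop_drop le_add_diff_inverse2)
    then show ?thesis unfolding seg_def by (metis set_append)
  qed
  have seg_nth: "\<exists>l. i \<le> l \<and> l < j \<and> v = c ! l" if "v \<in> seg i j" "j \<le> length c" for i j v
  proof -
    obtain l where "l < length (take (j - i) (drop i c))" "take (j - i) (drop i c) ! l = v"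
      using \<open>v \<in> seg i j\<close> unfolding seg_def by (meson in_set_conv_nth)
    then show ?thesis using \<open>j \<le> length c\<close> by (intro exI[of _ "i + l"]) auto
  qed
  have seg_card: "k < j - i" if "\<not> pierced F (seg i j) k" for i j
  proof -
    have "card (seg i j) \<le> j - i" unfolding seg_def
      using card_length[of "take (j - i) (drop i c)"] by simp
    moreover have "k < card (seg i j)" using that pierced_card[of "seg i j" k] unfolding seg_def by force
    ultimately show ?thesis by simp
  qed
  \<comment> \<open>Three consecutive segments are cut off, each costing at most \<open>K\<close> of
    the budget \<open>4 * K\<close>. The first and third play the roles of \<open>A\<close> and
    \<open>B\<close>; the second and the remainder keep them apart on both sides of the
    cycle.\<close>
  obtain j1 where j1: "0 < j1" "j1 \<le> length c" "\<not> pierced F (seg 0 j1) k" "pierced F (seg 0 j1) K"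
    using pierced_first_segment[of F 0 c k] npc[of k] Kk unfolding seg_def by auto
  have n1: "\<not> pierced F (set (drop j1 c)) (3 * K)"
  proof
    assume "pierced F (set (drop j1 c)) (3 * K)"
    from pierced_union[OF j1(4) this] show False using npc[of "4 * K"] drop_seg[of 0 j1] by simp
  qed
  then have "\<not> pierced F (set (drop j1 c)) k" using pierced_mono[of F "set (drop j1 c)" k _ "3 * K"] Kk by auto
  then obtain j2 where j2: "j1 < j2" "j2 \<le> length c" "\<not> pierced F (seg j1 j2) k" "pierced F (seg j1 j2) K"
    using pierced_first_segment[of F j1 c k] Kk unfolding seg_def by auto
  have n2: "\<not> pierced F (set (drop j2 c)) (2 * K)"
  proof
    assume "pierced F (set (drop j2 c)) (2 * K)"
    from pierced_union[OF j2(4) this] show False using n1 drop_seg[of j1 j2] j2(1) by simp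
  qed
  then have "\<not> pierced F (set (drop j2 c)) k" using pierced_mono[of F "set (drop j2 c)" k _ "2 * K"] Kk by auto
  then obtain j3 where j3: "j2 < j3" "j3 \<le> length c" "\<not> pierced F (seg j2 j3) k" "pierced F (seg j2 j3) K"
    using pierced_first_segment[of F j2 c k] Kk unfolding seg_def by auto
  have "\<not> pierced F (set (drop j3 c)) K"
  proof
    assume "pierced F (set (drop j3 c)) K"
    from pierced_union[OF j3(4) this] show False using n2 drop_seg[of j2 j3] j3(1) by (simp add: mult_2)
  qed
  then have j4: "K < length c - j3"
    using pierced_card[of "set (drop j3 c)" K] card_length[of "drop j3 c"] by fastforce
  \<comment> \<open>A walk witnessing an intersection has at most \<open>K\<close> edges, but both
    arcs between its ends have more.\<close>
  have "ball (seg 0 j1) K \<inter> seg j2 j3 = {}"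
  proof (rule ccontr)
    assume "\<not> ?thesis"
    then obtain v where v: "v \<in> ball (seg 0 j1) K" "v \<in> seg j2 j3" by blast
    obtain xs where xs: "walk_between E (seg 0 j1) {v} xs" "length xs \<le> Suc K" by (rule ball_walk[OF v(1)])
    obtain i where i: "i < j1" "hd xs = c ! i"
      using seg_nth[of "hd xs" 0 j1] j1(2) xs(1) by (auto simp: walk_between_def)
    obtain j where j: "j2 \<le> j" "j < j3" "v = c ! j" using seg_nth[OF v(2) j3(2)] by blast
    have "walk_between E {c ! i} {c ! j} xs" using xs(1) i(2) j(3) by (auto simp: walk_between_def)
    then have "\<bar>int i - int j\<bar> < int (length xs) \<or> int (length c) < \<bar>int i - int j\<bar> + int (length xs)"
      using i(1) j(2) j1(2) j3(2) npc[of "2 * (2 * K - 1)"]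
      by (intro minimal_cycle_isometric[OF c(1) min]) auto
    moreover have "k < j2 - j1" using seg_card[OF j2(3)] .
    ultimately show False using xs(2) i(1) j(1,2) j4 j2(1) j3(2) Kk by linarith
  qed
  moreover have "set c \<subseteq> V"
  proof
    fix v assume "v \<in> set c"
    then obtain us ws where "c = us @ v # ws" by (meson split_list)
    then show "v \<in> V" using c(1) EV EV2 unfolding cyclic_path_def
      by (cases ws) (auto simp: successively_append_iff)
  qed
  then have "seg 0 j1 \<subseteq> V" unfolding seg_def using set_take_subset by fastforce
  ultimately have "K * Suc k < card (ball (seg 0 j1) K)"
    using ball_card[of "seg 0 j1" k "seg j2 j3" K] j1(3) j3(3) by blast
  also have "\<dots> \<le> card V" using ball_subset[OF \<open>seg 0 j1 \<subseteq> V\<close>] finV by (simp add: card_mono)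
  finally show False using K(2) Kk by simp
qed

end

section \<open>Longest paths and cycles of a graph\<close>

lemma half_path:
  assumes "symp E" "successively E xs" "distinct xs" "x \<in> set xs"
  obtains p where "successively E (p @ [x])" "distinct (p @ [x])" "set (p @ [x]) \<subseteq> set xs"
    "length xs \<le> 2 * length p + 1"
proof -
  obtain us vs where e: "xs = us @ x # vs" using assms(4) by (meson split_list)
  have "successively E (us @ [x])" "successively E (rev (x # vs))"
    using successively_splitD[of E us x vs] assms(2) e successively_rev_symp[OF assms(1), of "x # vs"] by simp_all
  then show ?thesis
    using that[of us] that[of "rev vs"] assms(3) e by fastforce
qed

text \<open>Keep the longer side of each path as seen from the end of the link. The two sides have
  at least \<open>length xs - 1\<close> vertices together, and \<open>x\<close> and \<open>y\<close>
  add two more.\<close>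

lemma disjoint_paths_extend:
  assumes E: "symp E" and xs: "successively E xs" "distinct xs" and ys: "successively E ys" "distinct ys"
    and disj: "set xs \<inter> set ys = {}" and len: "length xs = length ys"
    and w: "walk_between E (set xs) (set ys) w"
  obtains zs where "successively E zs" "distinct zs" "set zs \<subseteq> set xs \<union> set ys \<union> set w" "length xs < length zs"
proof -
  obtain p where p: "walk_between E (set xs) (set ys) p" "distinct p" "set p \<subseteq> set w"
    "set p \<inter> set xs = {hd p}" "set p \<inter> set ys = {last p}"
    by (rule walk_between_trim[OF w])
  obtain x d y where d: "p = x # d @ [y]" "x \<in> set xs" "y \<in> set ys"
    "set d \<inter> (set xs \<union> set ys) = {}" "distinct d"
    using chord_walk_shape[OF p(1,2,4,5) disj] .
  obtain a where a: "successively E (a @ [x])" "distinct (a @ [x])" "set (a @ [x]) \<subseteq> set xs"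
    "length xs \<le> 2 * length a + 1"
    by (rule half_path[OF E xs d(2)])
  obtain b where b: "successively E (b @ [y])" "distinct (b @ [y])" "set (b @ [y]) \<subseteq> set ys"
    "length ys \<le> 2 * length b + 1"
    by (rule half_path[OF E ys d(3)])
  have "successively E (x # d @ [y])" using p(1) d(1) by (simp add: walk_between_def)
  from successively_join[OF a(1) this] have "successively E ((a @ x # d) @ [y])" by simp
  moreover have "successively E (y # rev b)"
    using successively_rev_symp[OF E, of "b @ [y]"] b(1) by simp
  ultimately have "successively E ((a @ x # d) @ y # rev b)"
    by (rule successively_join)
  moreover have "distinct ((a @ x # d) @ y # rev b)" using a(2,3) b(2,3) d(2-5) disj by auto
  moreover have "set ((a @ x # d) @ y # rev b) \<subseteq> set xs \<union> set ys \<union> set w" using a(3) b(3) d(1) p(3) by auto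
  moreover have "length xs < length ((a @ x # d) @ y # rev b)" using a(4) b(4) len by simp
  ultimately show ?thesis by (rule that)
qed

text \<open>Menger's theorem gives two disjoint links; joining their ends by the longer arc of each
  cycle uses at least \<open>length c + 2\<close> vertices.\<close>

lemma disjoint_cycles_extend:
  assumes E: "symp E" and fin: "finite {(x, y). E x y}" and c: "cyclic_path E c" "cyclic_path E c'"
    and disj: "set c \<inter> set c' = {}" and len: "length c = length c'"
    and link: "\<And>x. \<exists>w. walk_between E (set c) (set c') w \<and> x \<notin> set w"
  obtains d where "cyclic_path E d" "length c < length d"
proof -
  obtain p q where p: "walk_between E (set c) (set c') p" "distinct p" "set p \<inter> set c = {hd p}" "set p \<inter> set c' = {last p}"
    and q: "walk_between E (set c) (set c') q" "distinct q" "set q \<inter> set c = {hd q}" "set q \<inter> set c' = {last q}"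
    and pq: "set p \<inter> set q = {}"
    by (rule menger_two[OF fin link])
  obtain x1 e1 y1 where d1: "p = x1 # e1 @ [y1]" "x1 \<in> set c" "y1 \<in> set c'"
    "set e1 \<inter> (set c \<union> set c') = {}" "distinct e1"
    using chord_walk_shape[OF p disj] .
  obtain x2 e2 y2 where d2: "q = x2 # e2 @ [y2]" "x2 \<in> set c" "y2 \<in> set c'"
    "set e2 \<inter> (set c \<union> set c') = {}" "distinct e2"
    using chord_walk_shape[OF q disj] .
  have ne: "x1 \<noteq> x2" "y2 \<noteq> y1" and ee: "set e1 \<inter> set e2 = {}" using pq d1(1) d2(1) by auto
  obtain a where a: "walk_between E {x1} {x2} a" "distinct a" "set a \<subseteq> set c" "length c + 2 \<le> 2 * length a"
    by (rule cyclic_path_long_arc[OF E c(1) d1(2) d2(2) ne(1)])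
  \<comment> \<open>This arc starts at \<open>y2\<close> because the new cycle runs along
    \<open>a\<close> to \<open>x2\<close>, over the second link to \<open>y2\<close>, then to
    \<open>y1\<close> and back over the first link.\<close>
  obtain b where b: "walk_between E {y2} {y1} b" "distinct b" "set b \<subseteq> set c'" "length c' + 2 \<le> 2 * length b"
    by (rule cyclic_path_long_arc[OF E c(2) d2(3) d1(3) ne(2)])
  obtain a0 where a0: "a = a0 @ [x2]" using a(1) by (metis append_butlast_last_id walk_between_def singletonD)
  obtain b0 where b0: "b = b0 @ [y1]" using b(1) by (metis append_butlast_last_id walk_between_def singletonD)
  obtain b1 where b1: "b = y2 # b1" using b(1) by (metis list.collapse walk_between_def singletonD)
  have s: "successively E (x1 # e1 @ [y1])" "successively E (x2 # e2 @ [y2])"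
    "successively E (a0 @ [x2])" "successively E (y2 # b1)"
    using p(1) q(1) d1(1) d2(1) a(1) a0 b(1) b1 by (auto simp only: walk_between_def)
  have r: "successively E ((y1 # rev e1) @ [x1])"
    using s(1) successively_rev_symp[OF E, of "x1 # e1 @ [y1]"] by simp
  have r1: "successively E (y1 # rev e1)" and r2: "E (last (y1 # rev e1)) x1"
    using iffD1[OF successively_append_iff r] by (blast, metis list.distinct(1) list.sel(1))
  have "successively E ((a0 @ x2 # e2) @ [y2])" using successively_join[OF s(3,2)] by simp
  from successively_join[OF this s(4)] have "successively E ((a0 @ x2 # e2) @ b0 @ [y1])"
    using b0 b1 by metis
  then have "successively E ((a0 @ x2 # e2 @ b0) @ [y1])" by simp
  from successively_join[OF this r1] have 1: "successively E ((a0 @ x2 # e2 @ b0) @ y1 # rev e1)" .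
  have "cyclic_path E ((a0 @ x2 # e2 @ b0) @ y1 # rev e1)" (is "cyclic_path E ?d")
    unfolding cyclic_path_def
  proof (intro conjI)
    show "distinct ?d"
      using a(2,3) b(2,3) d1(4,5) d2(4,5) ee disj unfolding a0 b0 by auto
    have "3 \<le> length c" using c(1) by (simp add: cyclic_path_def)
    then show "3 \<le> length ?d" using a(4) b(4) len unfolding a0 b0 by simp
    show "successively E ?d" using 1 .
    have "hd ?d = x1" using a(1) unfolding a0 walk_between_def by (cases a0) auto
    then show "E (last ?d) (hd ?d)"
      using r2 by simp
  qed
  moreover have "length c < length ?d" using a(4) b(4) len unfolding a0 b0 by simp
  ultimately show ?thesis by (rule that)
qed

section \<open>Paths and cycles under one description\<close>

definition constrained_path :: "'a set \<Rightarrow> ('a \<Rightarrow> 'a \<Rightarrow> bool) \<Rightarrow> ('a \<Rightarrow> 'a \<Rightarrow> bool) \<Rightarrow> 'a list \<Rightarrow> bool" where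
  "constrained_path V E R xs \<longleftrightarrow>
     xs \<noteq> [] \<and> set xs \<subseteq> V \<and> successively E xs \<and> distinct xs \<and> R (hd xs) (last xs)"

text \<open>With \<open>R\<close> the converse of adjacency these are the longest cycles, provided there is a cycle;
  the closed lists \<open>[x, y]\<close> are then too short to matter.\<close>

definition longest_constrained :: "'a set \<Rightarrow> ('a \<Rightarrow> 'a \<Rightarrow> bool) \<Rightarrow> ('a \<Rightarrow> 'a \<Rightarrow> bool) \<Rightarrow> 'a list set" where
  "longest_constrained V E R =
     {xs. constrained_path V E R xs \<and> (\<forall>ys. constrained_path V E R ys \<longrightarrow> length ys \<le> length xs)}"

text \<open>A detour leaves the first and last vertex unchanged, so \<open>R\<close> still holds and
  maximality bounds the detour.\<close>

lemma unimprovable_longest_constrained: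
  assumes "finite V" "symp E" "\<And>x y. E x y \<Longrightarrow> x \<in> V"
    and meet: "\<And>X Y. X \<in> longest_constrained V E R \<Longrightarrow>
      Y \<in> longest_constrained V E R \<Longrightarrow> set X \<inter> set Y \<noteq> {}"
  shows "unimprovable_walks V E (longest_constrained V E R)"
proof (unfold_locales; (fact assms)?)
  fix X assume "X \<in> longest_constrained V E R"
  then show "successively E X \<and> distinct X \<and> set X \<subseteq> V"
    by (auto simp: longest_constrained_def constrained_path_def)
next
  fix us x vs y ws ps
  assume l: "us @ x # vs @ y # ws \<in> longest_constrained V E R" and s: "successively E (x # ps @ [y])"
    and d: "distinct (us @ x # ps @ y # ws)"
  have k: "constrained_path V E R (us @ x # vs @ y # ws)" using l by (simp add: longest_constrained_def)
  \<comment> \<open>Each interior vertex of the detour has an outgoing edge and hence lies in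
    \<open>V\<close>.\<close>
  have "z \<in> V" if z: "z \<in> set ps" for z
  proof -
    obtain as bs where e: "ps = as @ z # bs" using z by (meson split_list)
    then have "successively E (z # (bs @ [y]))"
      using s successively_splitD(2)[of E "x # as" z "bs @ [y]"] by simp
    then have "E z (hd (bs @ [y]))" by (cases bs) auto
    then show ?thesis by (rule assms(3))
  qed
  moreover have "successively E (us @ x # ps @ y # ws)"
  proof -
    have "successively E (us @ x # vs @ y # ws)" using k by (simp add: constrained_path_def)
    then have "successively E (us @ [x])" "successively E (y # ws)"
      using successively_splitD[of E us x "vs @ y # ws"] successively_splitD(2)[of E "us @ x # vs" y ws] by simp_all
    then show ?thesis
      using successively_join[of E "x # ps" y ws] successively_join[of E us x "ps @ y # ws"] s by simp
  qed
  moreover have "hd (us @ x # ps @ y # ws) = hd (us @ x # vs @ y # ws)" by (cases us) auto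
  ultimately have "constrained_path V E R (us @ x # ps @ y # ws)"
    using k d by (auto simp: constrained_path_def)
  then show "length ps \<le> length vs" using l by (fastforce simp: longest_constrained_def)
qed

lemma vpath_iff: "vpath p G \<longleftrightarrow> p \<noteq> [] \<and> set p \<subseteq> verts G \<and> successively (dominates G) p \<and> distinct p"
proof -
  have "set (vwalk_arcs p) \<subseteq> arcs_ends G \<longleftrightarrow> successively (dominates G) p"
    by (induction p rule: vwalk_arcs.induct) auto
  then show ?thesis by (auto simp: vpath_def vwalk_def)
qed

lemma longest_path_iff: "longest_path p G \<longleftrightarrow> p \<in> longest_constrained (verts G) (dominates G) (\<lambda>_ _. True)"
proof -
  have "vpath p G \<longleftrightarrow> constrained_path (verts G) (dominates G) (\<lambda>_ _. True) p" for p
    unfolding vpath_iff constrained_path_def by blast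
  \<comment> \<open>The truncated subtraction in \<open>vwalk_length\<close> is harmless because
    \<open>p\<close> is nonempty.\<close>
  moreover have "length q - 1 \<le> length p - 1 \<longleftrightarrow> length q \<le> length p" if "p \<noteq> []" for p q :: "'a list"
    using that by (cases p) auto
  ultimately show ?thesis
    unfolding longest_path_def longest_constrained_def vwalk_length_simp
    by (auto simp: constrained_path_def)
qed

lemma vcycle_iff_cyclic_path:
  "vcycle c G \<longleftrightarrow> cyclic_path (dominates G) c \<and> set c \<subseteq> verts G"
  unfolding vcycle_def vpath_iff cyclic_path_def by auto

lemma vcycle_iff_constrained_path:
  "vcycle c G \<longleftrightarrow> constrained_path (verts G) (dominates G) (\<lambda>x y. y \<rightarrow>\<^bsub>G\<^esub> x) c \<and> 3 \<le> length c"
  unfolding vcycle_def vpath_iff constrained_path_def by auto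

text \<open>A longest closed list is at least as long as \<open>c0\<close> and so has three
  vertices; conversely, closed lists with fewer than three vertices are shorter than any
  cycle.\<close>

lemma longest_cycle_iff:
  assumes "vcycle c0 G"
  shows "longest_cycle c G \<longleftrightarrow> c \<in> longest_constrained (verts G) (dominates G) (\<lambda>x y. y \<rightarrow>\<^bsub>G\<^esub> x)"
proof
  assume c: "longest_cycle c G"
  show "c \<in> longest_constrained (verts G) (dominates G) (\<lambda>x y. y \<rightarrow>\<^bsub>G\<^esub> x)"
    unfolding longest_constrained_def
  proof (clarsimp, intro conjI allI impI)
    show "constrained_path (verts G) (dominates G) (\<lambda>x y. y \<rightarrow>\<^bsub>G\<^esub> x) c"
      using c vcycle_iff_constrained_path unfolding longest_cycle_def by blast
    fix ys assume ys: "constrained_path (verts G) (dominates G) (\<lambda>x y. y \<rightarrow>\<^bsub>G\<^esub> x) ys"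
    show "length ys \<le> length c"
    proof (cases "3 \<le> length ys")
      case True
      then have "vcycle ys G" using ys vcycle_iff_constrained_path by blast
      then show ?thesis using c by (simp add: longest_cycle_def)
    next
      case False
      then show ?thesis using c unfolding longest_cycle_def vcycle_def by linarith
    qed
  qed
next
  assume c: "c \<in> longest_constrained (verts G) (dominates G) (\<lambda>x y. y \<rightarrow>\<^bsub>G\<^esub> x)"
  have "3 \<le> length c0" "length c0 \<le> length c"
    using assms c vcycle_iff_constrained_path[of c0 G] unfolding longest_constrained_def by blast+
  then show "longest_cycle c G"
    using c vcycle_iff_constrained_path[of _ G] unfolding longest_constrained_def longest_cycle_def by auto
qed

lemma walk_in_connected:
  assumes "wf_digraph H" "symmetric H" "Digraph_Component.connected H" "u \<in> verts H" "v \<in> verts H"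
  obtains w where "walk_between (dominates H) {u} {v} w" "set w \<subseteq> verts H"
proof -
  interpret H: wf_digraph H by fact
  have "u \<rightarrow>\<^sup>*\<^bsub>H\<^esub> v"
    using H.symmetric_connected_imp_strongly_connected[OF assms(2,3)] assms(4,5) by blast
  then obtain p where p: "vwalk p H" "hd p = u" "last p = v"
    using H.reachable_vwalk_conv by blast
  have "set (vwalk_arcs p) \<subseteq> arcs_ends H \<Longrightarrow> successively (dominates H) p"
    by (induction p rule: vwalk_arcs.induct) auto
  then show ?thesis using that[of p] p by (auto simp: vwalk_def walk_between_def)
qed

text \<open>For the rounded-up square root, \<open>K \<le> sqrt n + 1 \<le> 2 * sqrt n\<close> as
  \<open>n\<close> is positive. The exponent \<open>3/4\<close> is only a weakening of
  \<open>1/2\<close>.\<close>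

lemma square_bound_four:
  fixes n :: nat
  assumes "0 < n"
  obtains K where "0 < K" "n \<le> K * K" "real (4 * K) \<le> 8 * real n powr (3/4)"
proof
  define K where "K = nat \<lceil>sqrt (real n)\<rceil>"
  have s: "1 \<le> sqrt (real n)" using assms by simp
  have K: "sqrt (real n) \<le> real K" "real K \<le> sqrt (real n) + 1" unfolding K_def using s by linarith+
  show "0 < K" using K s by (cases K) auto
  have "sqrt (real n) * sqrt (real n) \<le> real K * real K" using K(1) s by (intro mult_mono) auto
  then show "n \<le> K * K" by (simp flip: of_nat_mult)
  have "sqrt (real n) = real n powr (1/2)" by (simp add: powr_half_sqrt)
  also have "\<dots> \<le> real n powr (3/4)" using assms by (intro powr_mono) auto
  finally have "4 * real K \<le> 8 * real n powr (3/4)" using K s by linarith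
  then show "real (4 * K) \<le> 8 * real n powr (3/4)" by simp
qed

theorem corollary2:
  fixes G :: "('a, 'b) pre_digraph" and n :: nat
  assumes "graph G" and "card (verts G) = n"
  shows "(Digraph_Component.connected G \<longrightarrow> real (lpt G) \<le> 8 * real n powr (3/4)) \<and>
         (k_connected 2 G \<longrightarrow> real (lct G) \<le> 20 * real n powr (3/4))"
proof -
  interpret graph G by fact
  let ?V = "verts G" and ?E = "dominates G"
  have symE: "symp ?E" using graph_symmetric by (auto intro: sympI)
  have EV: "x \<in> ?V" if "?E x y" for x y using that adj_in_verts by blast
  have finE: "finite {(x, y). ?E x y}" using finite_arcs by (simp add: arcs_ends_def)
  have pierce: "\<exists>S \<subseteq> ?V.
    (\<forall>X\<in>longest_constrained ?V ?E R. S \<inter> set X \<noteq> {}) \<and> real (card S) \<le> 8 * real n powr (3/4)"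
    if pos: "0 < n" and meet: "\<And>X Y. X \<in> longest_constrained ?V ?E R \<Longrightarrow> Y \<in> longest_constrained ?V ?E R
      \<Longrightarrow> set X \<inter> set Y \<noteq> {}" for R
  proof -
    obtain K where K: "0 < K" "n \<le> K * K" "real (4 * K) \<le> 8 * real n powr (3/4)"
      by (rule square_bound_four[OF pos])
    interpret unimprovable_walks ?V ?E "longest_constrained ?V ?E R"
    proof (rule unimprovable_longest_constrained)
      show "finite ?V" "symp ?E" by (simp_all add: symE)
      show "x \<in> ?V" if "?E x y" for x y by (rule EV[OF that])
      show "set X \<inter> set Y \<noteq> {}" if "X \<in> longest_constrained ?V ?E R" "Y \<in> longest_constrained ?V ?E R" for X Y
        by (rule meet[OF that])
    qed
    obtain S where S: "finite S" "card S \<le> 4 * K"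
      "\<forall>X\<in>longest_constrained ?V ?E R. set X \<noteq> {} \<longrightarrow> set X \<inter> S \<noteq> {}"
      using pierced_sqrt[OF K(1)] K(2) assms(2) unfolding pierced_def by auto
    \<comment> \<open>A transversal must consist of vertices of the graph, whereas \<open>S\<close>
      was unrestricted.\<close>
    have "card (S \<inter> ?V) \<le> 4 * K" using S(1,2) card_mono[of S "S \<inter> ?V"] by simp
    moreover have "(S \<inter> ?V) \<inter> set X \<noteq> {}" if X: "X \<in> longest_constrained ?V ?E R" for X
    proof -
      have "set X \<subseteq> ?V" using F_path[OF X] by simp
      moreover have "set X \<inter> S \<noteq> {}" using S(3) X meet[OF X X] by simp
      ultimately show ?thesis by auto
    qed
    moreover have "real (card (S \<inter> ?V)) \<le> real (4 * K)" using calculation(1) by (simp only: of_nat_le_iff)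
    ultimately show ?thesis using K(3) by (meson inf_le2 order_trans)
  qed
  have "real (lpt G) \<le> 8 * real n powr (3/4)" if con: "Digraph_Component.connected G"
  proof -
    have "?V \<noteq> {}" using con by (auto simp: connected_def strongly_connected_def)
    then have "0 < n" using assms(2) by (simp add: card_gt_0_iff flip: assms(2))
    moreover have "set X \<inter> set Y \<noteq> {}"
      if X: "X \<in> longest_constrained ?V ?E (\<lambda>_ _. True)" and Y: "Y \<in> longest_constrained ?V ?E (\<lambda>_ _. True)" for X Y
    proof
      assume disj: "set X \<inter> set Y = {}"
      have x: "X \<noteq> []" "set X \<subseteq> ?V" "successively ?E X" "distinct X"
        and y: "Y \<noteq> []" "set Y \<subseteq> ?V" "successively ?E Y" "distinct Y"
        and len: "length X = length Y"
        using X Y unfolding longest_constrained_def constrained_path_def by (auto intro: order_antisym)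
      obtain w where w: "walk_between ?E {hd X} {hd Y} w" "set w \<subseteq> ?V"
        using walk_in_connected[OF wf_digraph sym_arcs con, of "hd X" "hd Y"] x(1,2) y(1,2)
        by (metis hd_in_set subsetD)
      then have w': "walk_between ?E (set X) (set Y) w"
        using x(1) y(1) by (auto intro: walk_between_mono)
      obtain zs where zs: "successively ?E zs" "distinct zs" "set zs \<subseteq> set X \<union> set Y \<union> set w" "length X < length zs"
        by (rule disjoint_paths_extend[OF symE x(3,4) y(3,4) disj len w'])
      then have "constrained_path ?V ?E (\<lambda>_ _. True) zs"
        using x(2) y(2) w(2) by (auto simp: constrained_path_def)
      then show False using X zs(4) by (fastforce simp: longest_constrained_def)
    qed
    ultimately obtain S where S: "S \<subseteq> ?V" "\<forall>X\<in>longest_constrained ?V ?E (\<lambda>_ _. True). S \<inter> set X \<noteq> {}"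
      "real (card S) \<le> 8 * real n powr (3/4)" using pierce by meson
    have "longest_path_transversal S G"
      using S(1,2) unfolding longest_path_transversal_def longest_path_iff by blast
    then have "lpt G \<le> card S" unfolding lpt_def by (intro Least_le) blast
    then show ?thesis using S(3) by linarith
  qed
  moreover have "real (lct G) \<le> 20 * real n powr (3/4)" if con: "k_connected 2 G"
  proof -
    let ?R = "\<lambda>x y. y \<rightarrow>\<^bsub>G\<^esub> x"
    have "\<exists>S. longest_cycle_transversal S G \<and> real (card S) \<le> 8 * real n powr (3/4)"
    proof (cases "\<exists>c0. vcycle c0 G")
      \<comment> \<open>Without cycles the empty set is a transversal.\<close>
      case False
      then show ?thesis
        by (intro exI[of _ "{}"]) (auto simp: longest_cycle_transversal_def longest_cycle_def)
    next
      case True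
      then obtain c0 where c0: "vcycle c0 G" by blast
      have "0 < n" using con assms(2) by (simp add: k_connected_def)
      moreover have "set X \<inter> set Y \<noteq> {}"
        if X: "X \<in> longest_constrained ?V ?E ?R" and Y: "Y \<in> longest_constrained ?V ?E ?R" for X Y
      proof
        assume disj: "set X \<inter> set Y = {}"
        have lX: "longest_cycle X G" and lY: "longest_cycle Y G" using X Y longest_cycle_iff[OF c0] by auto
        then have len: "length X = length Y" by (auto simp: longest_cycle_def intro: order_antisym)
        have x: "cyclic_path ?E X" "set X \<subseteq> ?V" and y: "cyclic_path ?E Y" "set Y \<subseteq> ?V"
          using lX lY vcycle_iff_cyclic_path unfolding longest_cycle_def by blast+
        have pick: "\<exists>a\<in>set C. a \<noteq> z" if "cyclic_path ?E C" for C z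
        proof (rule ccontr)
          assume "\<not> ?thesis"
          then have "card (set C) \<le> card {z}" by (intro card_mono) auto
          then show False using that distinct_card[of C] by (simp add: cyclic_path_def)
        qed
        have link: "\<exists>w. walk_between ?E (set X) (set Y) w \<and> z \<notin> set w" for z
        proof -
          \<comment> \<open>Deleting one vertex keeps the graph connected, and each cycle retains a
            vertex other than \<open>z\<close>. The intersection covers a \<open>z\<close> outside
            the graph.\<close>
          define H where "H = G \<restriction> (?V - ({z} \<inter> ?V))"
          have "card ({z} \<inter> ?V) < 2" using card_mono[of "{z}" "{z} \<inter> ?V"] by simp
          then have "Digraph_Component.connected H" using con unfolding k_connected_def H_def by blast
          moreover have "symmetric H" unfolding H_def
            by (rule induced_graph_imp_symmetric[OF sym_arcs induced_induce]) auto
          moreover obtain a b where ab: "a \<in> set X" "a \<noteq> z" "b \<in> set Y" "b \<noteq> z" using pick x(1) y(1) by meson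
          ultimately obtain w where w: "walk_between (dominates H) {a} {b} w" "set w \<subseteq> verts H"
            using walk_in_connected[of H a b] x(2) y(2) wellformed_induce_subgraph unfolding H_def by auto
          have "walk_between ?E {a} {b} w"
            using w(1) unfolding walk_between_def H_def
            by (auto elim!: successively_mono dest: dominates_induce_subgraphD)
          then have "walk_between ?E (set X) (set Y) w" by (rule walk_between_mono) (use ab in auto)
          moreover have "z \<notin> set w" using w(2) by (auto simp: H_def)
          ultimately show ?thesis by blast
        qed
        obtain d where d: "cyclic_path ?E d" "length X < length d"
          by (rule disjoint_cycles_extend[OF symE finE x(1) y(1) disj len link])
        have "set d \<subseteq> ?V"
        proof
          fix v assume "v \<in> set d"
          then obtain us ws where e: "d = us @ v # ws" by (meson split_list)
          then have "cyclic_path ?E (v # ws @ us)" using d(1) cyclic_path_rotate[of ?E us "v # ws"] by simp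
          then have "?E (last (v # ws @ us)) v" by (simp add: cyclic_path_def)
          then show "v \<in> ?V" using EV symE by (meson sympD)
        qed
        then have "vcycle d G" using d(1) vcycle_iff_cyclic_path by blast
        then show False using lX d(2) by (auto simp: longest_cycle_def)
      qed
      ultimately obtain S where "S \<subseteq> ?V" "\<forall>X\<in>longest_constrained ?V ?E ?R. S \<inter> set X \<noteq> {}"
        "real (card S) \<le> 8 * real n powr (3/4)" using pierce by meson
      then show ?thesis unfolding longest_cycle_transversal_def longest_cycle_iff[OF c0] by blast
    qed
    then obtain S where S: "longest_cycle_transversal S G" "real (card S) \<le> 8 * real n powr (3/4)" by blast
    have "lct G \<le> card S" unfolding lct_def using S(1) by (intro Least_le) blast
    \<comment> \<open>The argument gives the constant 8 for cycles as well.\<close>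
    moreover have "8 * real n powr (3/4) \<le> 20 * real n powr (3/4)" by simp
    ultimately show ?thesis using S(2) by linarith
  qed
  ultimately show ?thesis by blast
qed

end
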